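(* Let $P$ be a $d$-dimensional polytope in $\mathbb{R}^d$, $d\ge1$, and let $\mathcal{N}=\{N_1,N_2,\dots,N_m\}$ be the family of inner unit normal vectors of the facets of $P$. If $\mathcal{N}$ has absolute rank $k$, then the inner neighborhood volume function $V_P(r)$ is a degree $d$ pluri-phase Steiner-like function of class $\mathcal{C}^{k-1}$ on $[0,+\infty)$.
   Context: A $d$-dimensional polytope in $\mathbb{R}^d$ is a compact convex set with non-empty interior that is the intersection of finitely many closed half-spaces. If $\{\mathcal{H}_1,\dots,\mathcal{H}_m\}$ is a minimal collection of closed half-spaces whose intersection is $P$, the facets of $P$ are $F_j=P\cap\partial\mathcal{H}_j$, and $N_j$ is the unit normal vector to $F_j$ pointing into $P$. For $r\ge0$, $P(r)=\{Q\in P:\mathrm{d}(Q,\partial P)\ge r\}$ and $V_P(r)=\mathrm{vol}_d(P\setminus P(r))$. A family of vectors $\mathcal{N}=\{N_1,\dots,N_m\}$ in $\mathbb{R}^d$ has absolute rank $k$ if (i) any $k$ elements of $\mathcal{N}$ are linearly independent, and (ii) there are $k+1$ vectors in the family that are linearly dependent. A degree $d$ pluri-phase Steiner-like function is a continuous function $\varphi:[0,+\infty)\to[0,+\infty)$ for which there are finitely many numbers $0=g_0<g_1<\dots<g_{m-1}<+\infty$ such that on each $[g_{i-1},g_i]$, $1\le i\le m-1$, $\varphi$ is a polynomial $\varphi(r)=\sum_{k=0}^d\kappa_{d-k,i}r^k$ with real coefficients (the leading coefficient is not required to be nonzero), and $\varphi$ is constant on $[g_{m-1},+\infty)$. (The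 number of intervals in this definition is unrelated to the number of facets.) Differentiability at $0$ is one-sided. *)

theory Defs
  imports "HOL-Analysis.Analysis"
begin

definition full_dim_polytope :: "'a::euclidean_space set \<Rightarrow> bool" where
  "full_dim_polytope P \<longleftrightarrow> compact P \<and> convex P \<and> interior P \<noteq> {} \<and> polyhedron P"

text \<open>Facets are taken in the library's sense. For a polytope with non-empty interior they are
  the sets cut out on the polytope by the boundaries of a minimal collection of closed half-spaces;
  see \<open>facets_eq_minimal_halfspaces\<close> below.\<close>

definition inner_unit_normal :: "'a::euclidean_space set \<Rightarrow> 'a set \<Rightarrow> 'a \<Rightarrow> bool" where
  "inner_unit_normal P F N \<longleftrightarrow>
     norm N = 1 \<and>
     (\<forall>x\<in>F. \<forall>y\<in>F. N \<bullet> (y - x) = 0) \<and>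
     (\<forall>x\<in>F. \<forall>y\<in>P. N \<bullet> (y - x) \<ge> 0)"

text \<open>Distinct facets have distinct inner unit normals, so no multiplicities are lost by
  collecting the family of normals into a set.\<close>

definition inner_normals :: "'a::euclidean_space set \<Rightarrow> 'a set" where
  "inner_normals P = {N. \<exists>F. F facet_of P \<and> inner_unit_normal P F N}"

definition absolute_rank :: "'a::real_vector set \<Rightarrow> nat \<Rightarrow> bool" where
  "absolute_rank \<N> k \<longleftrightarrow>
     (\<forall>S\<subseteq>\<N>. finite S \<and> card S = k \<longrightarrow> independent S) \<and>
     (\<exists>S\<subseteq>\<N>. finite S \<and> card S = k + 1 \<and> dependent S)"

definition inner_parallel_body :: "'a::euclidean_space set \<Rightarrow> real \<Rightarrow> 'a set" where
  "inner_parallel_body P r = {Q \<in> P. infdist Q (frontier P) \<ge> r}"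

definition inner_nbhd_volume :: "'a::euclidean_space set \<Rightarrow> real \<Rightarrow> real" where
  "inner_nbhd_volume P r = measure lebesgue (P - inner_parallel_body P r)"

text \<open>The breakpoints are \<open>0 = g 0 < \<dots> < g n\<close>. The \<open>i\<close>-th phase, numbered from \<open>0\<close>, is
  \<open>{g i..g (Suc i)}\<close>, and \<open>\<kappa> j i\<close> is the coefficient of degree \<open>d - j\<close> on that phase.\<close>

definition pluri_phase_steiner_like :: "nat \<Rightarrow> (real \<Rightarrow> real) \<Rightarrow> bool" where
  "pluri_phase_steiner_like d \<phi> \<longleftrightarrow>
     continuous_on {0..} \<phi> \<and>
     (\<forall>r\<ge>0. \<phi> r \<ge> 0) \<and>
     (\<exists>(n::nat) (g :: nat \<Rightarrow> real) (\<kappa> :: nat \<Rightarrow> nat \<Rightarrow> real).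
        g 0 = 0 \<and>
        (\<forall>i<n. g i < g (Suc i)) \<and>
        (\<forall>i<n. \<forall>r\<in>{g i..g (Suc i)}. \<phi> r = (\<Sum>k\<le>d. \<kappa> (d - k) i * r ^ k)) \<and>
        (\<exists>c. \<forall>r\<ge>g n. \<phi> r = c))"

text \<open>\<open>D j\<close> is the \<open>j\<close>-th derivative. Derivatives are taken relative to \<open>S\<close>, hence they are
  one-sided at \<open>0\<close> when \<open>S = {0..}\<close>.\<close>

definition class_C_on :: "nat \<Rightarrow> (real \<Rightarrow> real) \<Rightarrow> real set \<Rightarrow> bool" where
  "class_C_on n f S \<longleftrightarrow>
     (\<exists>D :: nat \<Rightarrow> real \<Rightarrow> real.
        (\<forall>x\<in>S. D 0 x = f x) \<and>
        (\<forall>j<n. \<forall>x\<in>S. (D j has_real_derivative D (Suc j) x) (at x within S)) \<and>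
        (\<forall>j\<le>n. continuous_on S (D j)))"

lemma facets_eq_minimal_halfspaces:
  fixes P :: "'a::euclidean_space set"
  assumes "interior P \<noteq> {}" "finite \<H>"
    and half: "\<And>H. H \<in> \<H> \<Longrightarrow> \<exists>a b. a \<noteq> 0 \<and> H = {x. a \<bullet> x \<le> b}"
    and P: "P = \<Inter>\<H>"
    and min: "\<And>\<K>. \<K> \<subset> \<H> \<Longrightarrow> \<Inter>\<K> \<noteq> P"
  shows "{F. F facet_of P} = (\<lambda>H. P \<inter> frontier H) ` \<H>"
proof -
  obtain a b where ab: "\<And>H. H \<in> \<H> \<Longrightarrow> a H \<noteq> 0 \<and> H = {x. a H \<bullet> x \<le> b H}"
    using half by metis
  have aff: "affine hull P = UNIV"
    using assms(1) affine_hull_nonempty_interior by blast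
  have "P = affine hull P \<inter> \<Inter>\<H>" using aff P by simp
  moreover have "P \<subset> affine hull P \<inter> \<Inter>\<K>" if "\<K> \<subset> \<H>" for \<K>
    using min[OF that] that aff P by auto
  ultimately have "F facet_of P \<longleftrightarrow> (\<exists>H. H \<in> \<H> \<and> F = P \<inter> {x. a H \<bullet> x = b H})" for F
    using facet_of_polyhedron_explicit[of \<H> P a b F] ab assms(2) by blast
  moreover have "frontier H = {x. a H \<bullet> x = b H}" if "H \<in> \<H>" for H
    using ab[OF that] frontier_halfspace_le[of "a H" "b H"] by metis
  ultimately show ?thesis by auto
qed

end

theory Submission
  imports Defs "HOL-Computational_Algebra.Polynomial"
begin

text \<open>
  The inner parallel body of \<open>P\<close> at distance \<open>r\<close> is obtained by moving every facet inwards by \<open>r\<close>: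
  if \<open>P\<close> is cut out by the inequalities \<open>b v \<le> v \<bullet> x\<close> with inner unit normals \<open>v\<close>, then the body is cut
  out by \<open>b v + r \<le> v \<bullet> x\<close> (\<open>inner_parallel_body_halfspaces\<close>). So the theorem is about the volume of
  a polyhedron with fixed normals whose bounds move affinely with \<open>r\<close>.

  The derivative of such a volume is a linear combination of the volumes of the facets
  (\<open>vol_line_has_derivative\<close>), and a facet is a polyhedron of the same kind, one dimension lower,
  whose normals are the old ones modulo the normal of the facet. Both claims follow by induction
  along this formula.

  If any \<open>k\<close> normals are independent, then any \<open>k - 1\<close> normals of a facet are independent. For \<open>k = 1\<close>
  the normals are nonzero and the volume is continuous. Hence it is of class \<open>k - 1\<close> in general
  (\<open>vol_line_class_C\<close>).

  If the facet volumes are piecewise polynomials of degree \<open>d - 1\<close>, then the volume is one of degree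
  \<open>d\<close>. This induction runs down to dimension \<open>0\<close>, where independence is exhausted: two facets may be
  parallel, and the formula for the derivative may fail at a parameter at which their hyperplanes
  coincide. These are finitely many points, apart from degenerate situations in which a constraint is redundant or the volume is zero
  (\<open>vol_line_piecewise_poly\<close>). Together with the continuity of the volume and its vanishing for large
  \<open>r\<close> this gives the phases (\<open>piecewise_poly_imp_pluri_phase\<close>).
\<close>

section \<open>Volumes of polyhedra with moving bounds\<close>

text \<open>The coordinates range over an arbitrary finite index set rather than over a fixed Euclidean
  type, because the main induction passes from a polyhedron to its facets and thus lowers the
  dimension. The linear forms \<open>N i\<close> are fixed while the bounds \<open>\<beta>\<close> vary.\<close>

definition lin :: "'l set \<Rightarrow> ('l \<Rightarrow> real) \<Rightarrow> ('l \<Rightarrow> real) \<Rightarrow> real" where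
  "lin L v x = (\<Sum>l\<in>L. v l * x l)"

definition cell :: "'l set \<Rightarrow> 'i set \<Rightarrow> ('i \<Rightarrow> 'l \<Rightarrow> real) \<Rightarrow> ('i \<Rightarrow> real) \<Rightarrow> ('l \<Rightarrow> real) set" where
  "cell L I N \<beta> = {x \<in> space (Pi\<^sub>M L (\<lambda>_. lborel)). \<forall>i\<in>I. \<beta> i \<le> lin L (N i) x}"

definition vol :: "'l set \<Rightarrow> 'i set \<Rightarrow> ('i \<Rightarrow> 'l \<Rightarrow> real) \<Rightarrow> ('i \<Rightarrow> real) \<Rightarrow> real" where
  "vol L I N \<beta> = measure (Pi\<^sub>M L (\<lambda>_. lborel)) (cell L I N \<beta>)"

text \<open>This makes all polyhedra with the forms \<open>N i\<close> bounded, uniformly as long as the bounds stay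
  above \<open>- C\<close>. It depends on the linear forms alone and is inherited by facets, so it survives the
  induction on the dimension.\<close>

definition bounding :: "'l set \<Rightarrow> 'i set \<Rightarrow> ('i \<Rightarrow> 'l \<Rightarrow> real) \<Rightarrow> bool" where
  "bounding L I N \<longleftrightarrow>
     (\<forall>C\<ge>0. \<exists>M. \<forall>x. (\<forall>i\<in>I. - C \<le> lin L (N i) x) \<longrightarrow> (\<forall>l\<in>L. \<bar>x l\<bar> \<le> M))"

text \<open>On the hyperplane \<open>lin L (N j) x = \<beta> j\<close> the coordinate \<open>x l\<close> is determined by the other ones.
  Substituting it into the remaining inequalities gives the forms \<open>elim_normal N j l i\<close> and the
  bounds \<open>elim_bound N j l \<beta> i\<close>. This projection of the facet along a coordinate axis replaces the
  orthogonal projection: it changes the facet volume only by the factor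
  \<open>\<bar>N j l\<bar> / norm (N j)\<close>.\<close>

definition elim_normal :: "('i \<Rightarrow> 'l \<Rightarrow> real) \<Rightarrow> 'i \<Rightarrow> 'l \<Rightarrow> 'i \<Rightarrow> 'l \<Rightarrow> real" where
  "elim_normal N j l i m = N i m - N i l / N j l * N j m"

definition elim_bound :: "('i \<Rightarrow> 'l \<Rightarrow> real) \<Rightarrow> 'i \<Rightarrow> 'l \<Rightarrow> ('i \<Rightarrow> real) \<Rightarrow> 'i \<Rightarrow> real" where
  "elim_bound N j l \<beta> i = \<beta> i - N i l / N j l * \<beta> j"

definition facet_vol :: "'l set \<Rightarrow> 'i set \<Rightarrow> ('i \<Rightarrow> 'l \<Rightarrow> real) \<Rightarrow> 'i \<Rightarrow> 'l \<Rightarrow> ('i \<Rightarrow> real) \<Rightarrow> real" where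
  "facet_vol L I N j l \<beta> = vol (L - {l}) (I - {j}) (elim_normal N j l) (elim_bound N j l \<beta>)"

lemma lin_measurable [measurable]: "lin L v \<in> borel_measurable (Pi\<^sub>M L (\<lambda>_. lborel))"
  unfolding lin_def by measurable

lemma lin_measurable_comp [measurable]:
  "f \<in> measurable M (Pi\<^sub>M L (\<lambda>_. lborel)) \<Longrightarrow> (\<lambda>x. lin L v (f x)) \<in> borel_measurable M"
  by (rule measurable_compose[OF _ lin_measurable])

lemma cell_sets [measurable]:
  assumes "finite I" shows "cell L I N \<beta> \<in> sets (Pi\<^sub>M L (\<lambda>_. lborel))"
  unfolding cell_def using assms by measurable

lemma cell_bound_upd:
  assumes "j \<in> I" "x \<in> space (Pi\<^sub>M L (\<lambda>_. lborel))"
  shows "x \<in> cell L I N (\<beta>(j := r)) \<longleftrightarrow>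
    r \<le> lin L (N j) x \<and> (\<forall>i\<in>I - {j}. \<beta> i \<le> lin L (N i) x)"
  using assms unfolding cell_def by auto

lemma lin_fun_upd:
  assumes "finite L" "l \<in> L"
  shows "lin L v (y(l := z)) = lin (L - {l}) v y + v l * z"
  unfolding lin_def using assms by (subst sum.remove[of L l]) (auto intro!: sum.cong)

lemma lin_elim:
  assumes "finite L" "l \<in> L" "N j l \<noteq> 0"
  shows "lin L (N i) (y(l := (u - lin (L - {l}) (N j) y) / N j l))
       = lin (L - {l}) (elim_normal N j l i) y + N i l / N j l * u"
proof -
  have "lin (L - {l}) (elim_normal N j l i) y
      = lin (L - {l}) (N i) y - N i l / N j l * lin (L - {l}) (N j) y"
    unfolding lin_def elim_normal_def
    by (simp add: algebra_simps sum_subtractf sum_distrib_left)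
  then show ?thesis using assms by (simp add: lin_fun_upd[OF assms(1,2)] field_simps)
qed

lemma bounding_elim:
  assumes "finite L" "l \<in> L" "N j l \<noteq> 0" "bounding L I N"
  shows "bounding (L - {l}) (I - {j}) (elim_normal N j l)"
  unfolding bounding_def
proof (intro allI impI)
  fix C :: real assume C: "C \<ge> 0"
  then obtain M where M: "\<And>x. (\<forall>i\<in>I. - C \<le> lin L (N i) x) \<Longrightarrow> (\<forall>l\<in>L. \<bar>x l\<bar> \<le> M)"
    using assms(4) unfolding bounding_def by blast
  show "\<exists>M. \<forall>y. (\<forall>i\<in>I - {j}. - C \<le> lin (L - {l}) (elim_normal N j l i) y)
      \<longrightarrow> (\<forall>m\<in>L - {l}. \<bar>y m\<bar> \<le> M)"
  proof (intro exI[of _ M] allI impI)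
    fix y assume y: "\<forall>i\<in>I - {j}. - C \<le> lin (L - {l}) (elim_normal N j l i) y"
    \<comment> \<open>Lift \<open>y\<close> to the hyperplane on which the form \<open>N j\<close> vanishes.\<close>
    let ?x = "y(l := (0 - lin (L - {l}) (N j) y) / N j l)"
    have "lin L (N j) ?x = 0"
      using lin_fun_upd[OF assms(1,2)] assms(3) by simp
    moreover have "lin L (N i) ?x = lin (L - {l}) (elim_normal N j l i) y" for i
      using lin_elim[of L l N j i y 0] assms(1-3) by simp
    ultimately have "\<forall>i\<in>I. - C \<le> lin L (N i) ?x"
      using y C by (metis DiffI neg_le_0_iff_le singletonD)
    then have "\<forall>m\<in>L. \<bar>?x m\<bar> \<le> M" by (rule M)
    then show "\<forall>m\<in>L - {l}. \<bar>y m\<bar> \<le> M" by (metis DiffE fun_upd_other insertI1)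
  qed
qed

text \<open>All these cells lie in one common box.\<close>

lemma vol_bounded:
  assumes L: "finite L" and I: "finite I" and "bounding L I N" and "C \<ge> 0"
  shows "\<exists>B. \<forall>\<beta>. (\<forall>i\<in>I. - C \<le> \<beta> i) \<longrightarrow>
      emeasure (Pi\<^sub>M L (\<lambda>_. lborel)) (cell L I N \<beta>) < \<infinity> \<and> vol L I N \<beta> \<le> B"
proof -
  interpret product_sigma_finite "\<lambda>_::'a. lborel :: real measure" by standard
  obtain M where M: "\<And>x. (\<forall>i\<in>I. - C \<le> lin L (N i) x) \<Longrightarrow> (\<forall>l\<in>L. \<bar>x l\<bar> \<le> M)"
    using assms(3,4) unfolding bounding_def by blast
  let ?box = "Pi\<^sub>E L (\<lambda>_. {- \<bar>M\<bar>..\<bar>M\<bar>})"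
  have box: "emeasure (Pi\<^sub>M L (\<lambda>_. lborel)) ?box = ennreal ((2 * \<bar>M\<bar>) ^ card L)"
    using L by (subst emeasure_PiM) (auto simp: prod_constant ennreal_power)
  have "emeasure (Pi\<^sub>M L (\<lambda>_. lborel)) (cell L I N \<beta>) \<le> ennreal ((2 * \<bar>M\<bar>) ^ card L)"
    if "\<forall>i\<in>I. - C \<le> \<beta> i" for \<beta>
  proof -
    have "cell L I N \<beta> \<subseteq> ?box"
    proof
      fix x assume x: "x \<in> cell L I N \<beta>"
      then have "\<forall>i\<in>I. - C \<le> lin L (N i) x" using that unfolding cell_def by force
      then have "\<forall>l\<in>L. \<bar>x l\<bar> \<le> M" by (rule M)
      then show "x \<in> ?box" using x unfolding cell_def
        by (force simp: space_PiM PiE_iff abs_le_iff)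
    qed
    then show ?thesis unfolding box[symmetric]
      by (intro emeasure_mono) (auto intro!: sets_PiM_I_finite L)
  qed
  note le = this
  show ?thesis
  proof (intro exI[of _ "(2 * \<bar>M\<bar>) ^ card L"] allI impI conjI)
    fix \<beta> assume \<beta>: "\<forall>i\<in>I. - C \<le> \<beta> i"
    show "emeasure (Pi\<^sub>M L (\<lambda>_. lborel)) (cell L I N \<beta>) < \<infinity>"
      using le[OF \<beta>] ennreal_less_top le_less_trans unfolding infinity_ennreal_def by blast
    show "vol L I N \<beta> \<le> (2 * \<bar>M\<bar>) ^ card L"
      unfolding vol_def measure_def using le[OF \<beta>] by (intro enn2real_leI) auto
  qed
qed

lemma finite_lower_bound:
  fixes \<beta> :: "'i \<Rightarrow> real"
  assumes "finite I" shows "\<exists>C\<ge>0. \<forall>i\<in>I. - C \<le> \<beta> i"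
proof (intro exI conjI ballI)
  show "0 \<le> (\<Sum>i\<in>I. \<bar>\<beta> i\<bar>)" by (simp add: sum_nonneg)
  show "- (\<Sum>i\<in>I. \<bar>\<beta> i\<bar>) \<le> \<beta> i" if "i \<in> I" for i
    using member_le_sum[OF that, of "\<lambda>i. \<bar>\<beta> i\<bar>"] assms by fastforce
qed

lemma emeasure_cell:
  assumes "finite L" "finite I" "bounding L I N"
  shows "emeasure (Pi\<^sub>M L (\<lambda>_. lborel)) (cell L I N \<beta>) = ennreal (vol L I N \<beta>)"
proof -
  obtain C where "C \<ge> 0" "\<forall>i\<in>I. - C \<le> \<beta> i" using finite_lower_bound[OF assms(2)] by blast
  then have "emeasure (Pi\<^sub>M L (\<lambda>_. lborel)) (cell L I N \<beta>) < \<infinity>"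
    using vol_bounded[OF assms] by blast
  then show ?thesis unfolding vol_def
    by (intro emeasure_eq_ennreal_measure) auto
qed

lemma vol_nonneg: "0 \<le> vol L I N \<beta>"
  unfolding vol_def by simp

text \<open>Raising the bound \<open>\<beta> j\<close> from \<open>s\<close> to \<open>t\<close> cuts off a slab. By Fubini, with \<open>u = lin L (N j) x\<close> as
  new coordinate in place of \<open>x l\<close>, the volume of the slab is the integral of the projected slice
  volumes over \<open>u \<in> {s..t}\<close>, divided by the Jacobian \<open>\<bar>N j l\<bar>\<close>. Only the resulting two-sided
  estimate is recorded; it yields Lipschitz bounds as well as derivatives.\<close>

lemma vol_increment:
  assumes L: "finite L" "l \<in> L" and I: "finite I" "j \<in> I" and nz: "N j l \<noteq> 0"
    and bd: "bounding L I N" and st: "s \<le> t"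
    and lo: "0 \<le> lo"
    and h: "\<And>u. s \<le> u \<Longrightarrow> u \<le> t \<Longrightarrow>
        lo \<le> facet_vol L I N j l (\<beta>(j := u)) \<and> facet_vol L I N j l (\<beta>(j := u)) \<le> hi"
  shows "lo * (t - s) \<le> \<bar>N j l\<bar> * (vol L I N (\<beta>(j := s)) - vol L I N (\<beta>(j := t)))"
    and "\<bar>N j l\<bar> * (vol L I N (\<beta>(j := s)) - vol L I N (\<beta>(j := t))) \<le> hi * (t - s)"
proof -
  interpret product_sigma_finite "\<lambda>_::'a. lborel :: real measure" by standard
  define L' where "L' = L - {l}"
  have L': "finite L'" "l \<notin> L'" "insert l L' = L" using L by (auto simp: L'_def)
  interpret L': finite_product_sigma_finite "\<lambda>_::'a. lborel :: real measure" L'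
    by standard (rule L')
  interpret pair: pair_sigma_finite "Pi\<^sub>M L' (\<lambda>_::'a. lborel :: real measure)" "lborel :: real measure"
    by standard
  let ?E = "cell L I N"
  let ?D = "?E (\<beta>(j := s)) - ?E (\<beta>(j := t))"
  let ?F = "\<lambda>u. cell L' (I - {j}) (elim_normal N j l) (elim_bound N j l (\<beta>(j := u)))"
  have sub: "?E (\<beta>(j := t)) \<subseteq> ?E (\<beta>(j := s))"
    unfolding cell_def using st I(2) by fastforce
  have D_meas [measurable]: "?D \<in> sets (Pi\<^sub>M (insert l L') (\<lambda>_. lborel))"
    unfolding L'(3) using cell_sets[OF I(1)] by auto
  have D_vol: "emeasure (Pi\<^sub>M L (\<lambda>_. lborel)) ?D = ennreal (vol L I N (\<beta>(j := s)) - vol L I N (\<beta>(j := t)))"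
    using sub by (subst emeasure_Diff)
      (auto simp: emeasure_cell[OF L(1) I(1) bd] cell_sets[OF I(1)] ennreal_minus vol_nonneg)
  \<comment> \<open>In the coordinates \<open>(y, u)\<close> the slab is the region over \<open>{s..<t}\<close> with slices \<open>?F u\<close>.\<close>
  have D_iff: "y(l := (u - lin L' (N j) y) / N j l) \<in> ?D \<longleftrightarrow> u \<in> {s..<t} \<and> y \<in> ?F u"
    if y: "y \<in> space (Pi\<^sub>M L' (\<lambda>_. lborel))" for y u
  proof -
    let ?x = "y(l := (u - lin L' (N j) y) / N j l)"
    have sp: "?x \<in> space (Pi\<^sub>M L (\<lambda>_. lborel))"
      using y L' by (auto simp: space_PiM PiE_iff extensional_def)
    have linj: "lin L (N j) ?x = u"
      using lin_fun_upd[OF L] nz by (simp add: L'_def)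
    have lini: "lin L (N i) ?x = lin L' (elim_normal N j l i) y + N i l / N j l * u" for i
      using lin_elim[of L l N j i y u] L nz by (simp add: L'_def)
    have E_iff: "?x \<in> ?E (\<beta>(j := r)) \<longleftrightarrow> r \<le> u \<and>
        (\<forall>i\<in>I - {j}. \<beta> i \<le> lin L' (elim_normal N j l i) y + N i l / N j l * u)" for r
      unfolding cell_bound_upd[OF I(2) sp] linj unfolding lini ..
    have F_iff: "y \<in> ?F u \<longleftrightarrow>
        (\<forall>i\<in>I - {j}. \<beta> i \<le> lin L' (elim_normal N j l i) y + N i l / N j l * u)"
      unfolding cell_def elim_bound_def using y by (simp add: diff_le_eq)
    show ?thesis unfolding Diff_iff E_iff F_iff by auto
  qed
  have meas_joint: "(\<lambda>(y, u). indicator {s..<t} u * indicator (?F u) y :: ennreal)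
      \<in> borel_measurable (Pi\<^sub>M L' (\<lambda>_. lborel) \<Otimes>\<^sub>M lborel)"
  proof -
    have "(\<lambda>p. indicator {s..<t} (snd p) * indicator {q \<in> space (Pi\<^sub>M L' (\<lambda>_. lborel) \<Otimes>\<^sub>M lborel).
        \<forall>i\<in>I - {j}. \<beta> i - N i l / N j l * snd q \<le> lin L' (elim_normal N j l i) (fst q)} p :: ennreal)
      \<in> borel_measurable (Pi\<^sub>M L' (\<lambda>_. lborel) \<Otimes>\<^sub>M lborel)"
      using finite_Diff[OF I(1), of "{j}"] by measurable
    then show ?thesis
      by (rule measurable_cong[THEN iffD1, rotated])
        (auto simp: cell_def elim_bound_def space_pair_measure indicator_def)
  qed
  have "emeasure (Pi\<^sub>M L (\<lambda>_. lborel)) ?D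
      = (\<integral>\<^sup>+x. indicator ?D x \<partial>Pi\<^sub>M (insert l L') (\<lambda>_. lborel))"
    using D_meas by (simp add: L'(3))
  also have "\<dots> = (\<integral>\<^sup>+y. \<integral>\<^sup>+z. indicator ?D (y(l := z)) \<partial>lborel \<partial>Pi\<^sub>M L' (\<lambda>_. lborel))"
    by (rule product_nn_integral_insert[OF L'(1,2)]) measurable
  also have "\<dots> = (\<integral>\<^sup>+y. \<integral>\<^sup>+u. ennreal (1 / \<bar>N j l\<bar>) * (indicator {s..<t} u * indicator (?F u) y)
      \<partial>lborel \<partial>Pi\<^sub>M L' (\<lambda>_. lborel))"
  proof (rule nn_integral_cong)
    fix y assume y: "y \<in> space (Pi\<^sub>M L' (\<lambda>_. lborel :: real measure))"
    have [measurable]: "(\<lambda>z. y(l := z)) \<in> borel \<rightarrow>\<^sub>M Pi\<^sub>M (insert l L') (\<lambda>_. lborel)"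
      using y by (intro measurable_fun_upd[where J = L']) auto
    have [measurable]: "(\<lambda>z. indicator ?D (y(l := z)) :: ennreal) \<in> borel_measurable borel"
      by measurable
    have "(\<lambda>u. indicator {s..<t} u * indicator (?F u) y :: ennreal) \<in> borel_measurable lborel"
      using measurable_Pair2[OF meas_joint y] by simp
    then have [measurable]: "(\<lambda>u. indicator {s..<t} u * indicator (?F u) y :: ennreal) \<in> borel_measurable borel"
      by simp
    have "(\<integral>\<^sup>+z. indicator ?D (y(l := z)) \<partial>lborel) = ennreal \<bar>1 / N j l\<bar> *
        (\<integral>\<^sup>+u. indicator ?D (y(l := - lin L' (N j) y / N j l + 1 / N j l * u)) \<partial>lborel)"
      by (rule nn_integral_real_affine) (use nz in auto)
    also have "(\<integral>\<^sup>+u. indicator ?D (y(l := - lin L' (N j) y / N j l + 1 / N j l * u)) \<partial>lborel)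
        = (\<integral>\<^sup>+u. indicator {s..<t} u * indicator (?F u) y \<partial>lborel)"
    proof (rule nn_integral_cong)
      fix u :: real
      have "- lin L' (N j) y / N j l + 1 / N j l * u = (u - lin L' (N j) y) / N j l"
        by (simp add: field_simps diff_divide_distrib)
      then show "indicator ?D (y(l := - lin L' (N j) y / N j l + 1 / N j l * u))
          = (indicator {s..<t} u * indicator (?F u) y :: ennreal)"
        using D_iff[OF y, of u] by (auto simp: indicator_def)
    qed
    also have "ennreal \<bar>1 / N j l\<bar> * \<dots> = (\<integral>\<^sup>+u. ennreal (1 / \<bar>N j l\<bar>) *
        (indicator {s..<t} u * indicator (?F u) y) \<partial>lborel)"
      by (subst nn_integral_cmult) auto
    finally show "(\<integral>\<^sup>+z. indicator ?D (y(l := z)) \<partial>lborel) = \<dots>" .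
  qed
  also have "\<dots> = (\<integral>\<^sup>+u. \<integral>\<^sup>+y. ennreal (1 / \<bar>N j l\<bar>) * (indicator {s..<t} u * indicator (?F u) y)
      \<partial>Pi\<^sub>M L' (\<lambda>_. lborel) \<partial>lborel)"
    by (rule pair.Fubini'[symmetric])
      (use borel_measurable_times_ennreal[OF borel_measurable_const meas_joint, of "ennreal (1 / \<bar>N j l\<bar>)"]
        in \<open>simp add: case_prod_beta\<close>)
  also have "\<dots> = (\<integral>\<^sup>+u. ennreal (1 / \<bar>N j l\<bar>) * (indicator {s..<t} u *
      ennreal (facet_vol L I N j l (\<beta>(j := u)))) \<partial>lborel)"
  proof (rule nn_integral_cong)
    fix u :: real
    have [measurable]: "?F u \<in> sets (Pi\<^sub>M L' (\<lambda>_. lborel))" using cell_sets I(1) by blast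
    have "emeasure (Pi\<^sub>M L' (\<lambda>_. lborel)) (?F u) = ennreal (facet_vol L I N j l (\<beta>(j := u)))"
      unfolding facet_vol_def L'_def using bounding_elim[of L l N j I] L I nz bd
      by (intro emeasure_cell) auto
    then show "(\<integral>\<^sup>+y. ennreal (1 / \<bar>N j l\<bar>) * (indicator {s..<t} u * indicator (?F u) y)
        \<partial>Pi\<^sub>M L' (\<lambda>_. lborel)) = ennreal (1 / \<bar>N j l\<bar>) * (indicator {s..<t} u *
      ennreal (facet_vol L I N j l (\<beta>(j := u))))"
      by (simp add: nn_integral_cmult mult.assoc)
  qed
  finally have D_int: "emeasure (Pi\<^sub>M L (\<lambda>_. lborel)) ?D = \<dots>" .
  have const: "(\<integral>\<^sup>+u. ennreal (1 / \<bar>N j l\<bar>) * (indicator {s..<t} u * ennreal a) \<partial>lborel)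
      = ennreal (a * (t - s) / \<bar>N j l\<bar>)" if "0 \<le> a" for a
    using that st
    by (simp add: nn_integral_cmult nn_integral_multc ennreal_mult'[symmetric] field_simps)
  have hi: "0 \<le> hi" using h[of s] st lo by simp
  have "ennreal (lo * (t - s) / \<bar>N j l\<bar>) \<le> emeasure (Pi\<^sub>M L (\<lambda>_. lborel)) ?D"
    unfolding D_int const[OF lo, symmetric]
    by (intro nn_integral_mono, rule mult_left_mono)
      (auto split: split_indicator intro!: ennreal_leI dest: h)
  moreover have "emeasure (Pi\<^sub>M L (\<lambda>_. lborel)) ?D \<le> ennreal (hi * (t - s) / \<bar>N j l\<bar>)"
    unfolding D_int const[OF hi, symmetric]
    by (intro nn_integral_mono, rule mult_left_mono)
      (auto split: split_indicator intro!: ennreal_leI dest: h)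
  moreover have "0 \<le> vol L I N (\<beta>(j := s)) - vol L I N (\<beta>(j := t))"
    using measure_mono_fmeasurable[OF sub, of "Pi\<^sub>M L (\<lambda>_. lborel)"] cell_sets[OF I(1), of L N]
    unfolding vol_def by (simp add: fmeasurable_def emeasure_cell[OF L(1) I(1) bd])
  moreover have "0 \<le> lo * (t - s) / \<bar>N j l\<bar>" "0 \<le> hi * (t - s) / \<bar>N j l\<bar>"
    using lo hi st by auto
  ultimately have *: "lo * (t - s) / \<bar>N j l\<bar> \<le> vol L I N (\<beta>(j := s)) - vol L I N (\<beta>(j := t))"
    "vol L I N (\<beta>(j := s)) - vol L I N (\<beta>(j := t)) \<le> hi * (t - s) / \<bar>N j l\<bar>"
    unfolding D_vol by (simp_all add: ennreal_le_iff)
  show "lo * (t - s) \<le> \<bar>N j l\<bar> * (vol L I N (\<beta>(j := s)) - vol L I N (\<beta>(j := t)))"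
    and "\<bar>N j l\<bar> * (vol L I N (\<beta>(j := s)) - vol L I N (\<beta>(j := t))) \<le> hi * (t - s)"
    using * nz by (simp_all add: field_simps)
qed

section \<open>Continuity and derivative of the volume\<close>

text \<open>Closeness is measured on \<open>I\<close> only, since a cell sees no other bounds.\<close>

definition coord_cont :: "'i set \<Rightarrow> (('i \<Rightarrow> real) \<Rightarrow> real) \<Rightarrow> ('i \<Rightarrow> real) \<Rightarrow> bool" where
  "coord_cont I F \<beta>\<^sub>0 \<longleftrightarrow>
     (\<forall>\<epsilon>>0. \<exists>\<delta>>0. \<forall>\<beta>. (\<forall>i\<in>I. \<bar>\<beta> i - \<beta>\<^sub>0 i\<bar> < \<delta>) \<longrightarrow> \<bar>F \<beta> - F \<beta>\<^sub>0\<bar> < \<epsilon>)"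

text \<open>Passing from \<open>\<beta>\<^sub>0\<close> to \<open>\<beta>\<close> one coordinate at a time turns first-order estimates in each single
  coordinate into a joint one. With \<open>a = 0\<close> this is a Lipschitz bound; with partial derivatives
  for \<open>a\<close> and small \<open>e\<close> it is total differentiability.\<close>

lemma telescope:
  fixes F :: "('i \<Rightarrow> real) \<Rightarrow> real"
  assumes fin: "finite I"
    and dep: "\<And>\<beta> \<beta>'. (\<And>i. i \<in> I \<Longrightarrow> \<beta> i = \<beta>' i) \<Longrightarrow> F \<beta> = F \<beta>'"
    and step: "\<And>\<beta> j s t. j \<in> I \<Longrightarrow> (\<And>i. i \<in> I - {j} \<Longrightarrow> \<bar>\<beta> i - \<beta>\<^sub>0 i\<bar> < \<delta>) \<Longrightarrow>
        \<bar>s - \<beta>\<^sub>0 j\<bar> < \<delta> \<Longrightarrow> \<bar>t - \<beta>\<^sub>0 j\<bar> < \<delta> \<Longrightarrow> s \<le> t \<Longrightarrow>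
        \<bar>F (\<beta>(j := t)) - F (\<beta>(j := s)) - a j * (t - s)\<bar> \<le> e * (t - s)"
    and near: "\<And>i. i \<in> I \<Longrightarrow> \<bar>\<beta> i - \<beta>\<^sub>0 i\<bar> < \<delta>"
  shows "\<bar>F \<beta> - F \<beta>\<^sub>0 - (\<Sum>j\<in>I. a j * (\<beta> j - \<beta>\<^sub>0 j))\<bar> \<le> e * (\<Sum>j\<in>I. \<bar>\<beta> j - \<beta>\<^sub>0 j\<bar>)"
proof -
  define \<gamma> where "\<gamma> J i = (if i \<in> J then \<beta> i else \<beta>\<^sub>0 i)" for J i
  have "\<bar>F (\<gamma> J) - F \<beta>\<^sub>0 - (\<Sum>j\<in>J. a j * (\<beta> j - \<beta>\<^sub>0 j))\<bar> \<le> e * (\<Sum>j\<in>J. \<bar>\<beta> j - \<beta>\<^sub>0 j\<bar>)"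
    if "J \<subseteq> I" for J
    using finite_subset[OF that fin] that
  proof (induction J rule: finite_induct)
    case empty
    show ?case by (simp add: \<gamma>_def)
  next
    case (insert j J)
    have j: "j \<in> I" "\<bar>\<beta> j - \<beta>\<^sub>0 j\<bar> < \<delta>" using insert.prems near by auto
    then have \<delta>: "0 < \<delta>" by linarith
    have upd: "\<gamma> (insert j J) = (\<gamma> J)(j := \<beta> j)" "(\<gamma> J)(j := \<beta>\<^sub>0 j) = \<gamma> J"
      using insert.hyps by (auto simp: \<gamma>_def)
    have nb: "\<bar>\<gamma> J i - \<beta>\<^sub>0 i\<bar> < \<delta>" if "i \<in> I - {j}" for i
      using near that \<delta> by (auto simp: \<gamma>_def)
    have "\<bar>F (\<gamma> (insert j J)) - F (\<gamma> J) - a j * (\<beta> j - \<beta>\<^sub>0 j)\<bar> \<le> e * \<bar>\<beta> j - \<beta>\<^sub>0 j\<bar>"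
    proof (cases "\<beta>\<^sub>0 j \<le> \<beta> j")
      case True
      show ?thesis
        using step[of j "\<gamma> J" "\<beta>\<^sub>0 j" "\<beta> j"] j nb \<delta> True unfolding upd by simp
    next
      case False
      have "\<bar>F (\<gamma> J) - F (\<gamma> (insert j J)) - a j * (\<beta>\<^sub>0 j - \<beta> j)\<bar> \<le> e * (\<beta>\<^sub>0 j - \<beta> j)"
        using step[of j "\<gamma> J" "\<beta> j" "\<beta>\<^sub>0 j"] j nb \<delta> False unfolding upd by simp
      moreover have "F (\<gamma> J) - F (\<gamma> (insert j J)) - a j * (\<beta>\<^sub>0 j - \<beta> j)
          = - (F (\<gamma> (insert j J)) - F (\<gamma> J) - a j * (\<beta> j - \<beta>\<^sub>0 j))"
        by (simp add: algebra_simps)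
      ultimately show ?thesis using False by simp
    qed
    then show ?case
      using insert by (simp add: distrib_left)
  qed
  from this[of I] have "\<bar>F (\<gamma> I) - F \<beta>\<^sub>0 - (\<Sum>j\<in>I. a j * (\<beta> j - \<beta>\<^sub>0 j))\<bar>
      \<le> e * (\<Sum>j\<in>I. \<bar>\<beta> j - \<beta>\<^sub>0 j\<bar>)" by simp
  moreover have "F (\<gamma> I) = F \<beta>" by (rule dep) (simp add: \<gamma>_def)
  ultimately show ?thesis by simp
qed

lemma vol_cong_bound: "(\<And>i. i \<in> I \<Longrightarrow> \<beta> i = \<beta>' i) \<Longrightarrow> vol L I N \<beta> = vol L I N \<beta>'"
proof -
  assume "\<And>i. i \<in> I \<Longrightarrow> \<beta> i = \<beta>' i"
  then have "cell L I N \<beta> = cell L I N \<beta>'" by (simp add: cell_def)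
  then show ?thesis by (simp add: vol_def)
qed

lemma facet_vol_nonneg: "0 \<le> facet_vol L I N j l \<beta>"
  unfolding facet_vol_def by (rule vol_nonneg)

lemma facet_vol_bounded:
  assumes "finite L" "finite I" "bounding L I N" "j \<in> I" "l \<in> L" "N j l \<noteq> 0"
  shows "\<exists>B\<ge>0. \<forall>\<beta>. (\<forall>i\<in>I. \<bar>\<beta> i - \<beta>\<^sub>0 i\<bar> < 1) \<longrightarrow> facet_vol L I N j l \<beta> \<le> B"
proof -
  obtain C where C: "C \<ge> 0"
    "\<forall>i\<in>I. - C \<le> \<beta>\<^sub>0 i - 1 - \<bar>N i l / N j l\<bar> * (\<bar>\<beta>\<^sub>0 j\<bar> + 1)"
    using finite_lower_bound[OF assms(2), of "\<lambda>i. \<beta>\<^sub>0 i - 1 - \<bar>N i l / N j l\<bar> * (\<bar>\<beta>\<^sub>0 j\<bar> + 1)"] by blast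
  obtain B where B: "\<And>\<beta>. (\<forall>i\<in>I - {j}. - C \<le> \<beta> i) \<Longrightarrow>
      vol (L - {l}) (I - {j}) (elim_normal N j l) \<beta> \<le> B"
    using vol_bounded[OF _ _ bounding_elim[OF assms(1,5,6,3)] C(1)] assms(1,2) by blast
  show ?thesis
  proof (intro exI[of _ "max 0 B"] conjI allI impI)
    fix \<beta> assume \<beta>: "\<forall>i\<in>I. \<bar>\<beta> i - \<beta>\<^sub>0 i\<bar> < 1"
    have "- C \<le> elim_bound N j l \<beta> i" if i: "i \<in> I - {j}" for i
    proof -
      have "\<bar>\<beta> i - \<beta>\<^sub>0 i\<bar> < 1" "\<bar>\<beta> j - \<beta>\<^sub>0 j\<bar> < 1" using \<beta> i assms(4) by auto
      then have \<beta>: "\<bar>\<beta> j\<bar> \<le> \<bar>\<beta>\<^sub>0 j\<bar> + 1" "\<beta>\<^sub>0 i - 1 \<le> \<beta> i" by linarith+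
      have "N i l / N j l * \<beta> j \<le> \<bar>N i l / N j l\<bar> * \<bar>\<beta> j\<bar>"
        by (simp only: abs_mult[symmetric] abs_ge_self)
      also have "\<dots> \<le> \<bar>N i l / N j l\<bar> * (\<bar>\<beta>\<^sub>0 j\<bar> + 1)" by (rule mult_left_mono[OF \<beta>(1) abs_ge_zero])
      finally show ?thesis using bspec[OF C(2) DiffD1[OF i]] \<beta>(2) unfolding elim_bound_def by linarith
    qed
    then show "facet_vol L I N j l \<beta> \<le> max 0 B"
      unfolding facet_vol_def by (intro max.coboundedI2 B) blast
  qed simp
qed

text \<open>The facet volumes are bounded near \<open>\<beta>\<^sub>0\<close>, so the volume is Lipschitz in each bound.\<close>

lemma vol_coord_cont_nonzero:
  assumes fin: "finite L" "finite I" and bd: "bounding L I N"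
    and nz: "\<And>i. i \<in> I \<Longrightarrow> \<exists>l\<in>L. N i l \<noteq> 0"
  shows "coord_cont I (vol L I N) \<beta>\<^sub>0"
proof -
  obtain p where p: "\<And>j. j \<in> I \<Longrightarrow> p j \<in> L \<and> N j (p j) \<noteq> 0" using nz by metis
  have "\<exists>B. \<forall>j\<in>I. B j \<ge> 0 \<and>
      (\<forall>\<beta>. (\<forall>i\<in>I. \<bar>\<beta> i - \<beta>\<^sub>0 i\<bar> < 1) \<longrightarrow> facet_vol L I N j (p j) \<beta> \<le> B j)"
    using facet_vol_bounded[OF fin bd] p by (intro bchoice) blast
  then obtain B where B: "\<And>j. j \<in> I \<Longrightarrow> B j \<ge> 0"
    "\<And>j \<beta>. j \<in> I \<Longrightarrow> (\<forall>i\<in>I. \<bar>\<beta> i - \<beta>\<^sub>0 i\<bar> < 1) \<Longrightarrow> facet_vol L I N j (p j) \<beta> \<le> B j" by blast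
  define K where "K = (\<Sum>j\<in>I. B j / \<bar>N j (p j)\<bar>)"
  have K0: "K \<ge> 0" unfolding K_def using B(1) by (intro sum_nonneg) simp
  have lip: "\<bar>vol L I N \<beta> - vol L I N \<beta>\<^sub>0\<bar> \<le> K * (\<Sum>j\<in>I. \<bar>\<beta> j - \<beta>\<^sub>0 j\<bar>)"
    if near: "\<And>i. i \<in> I \<Longrightarrow> \<bar>\<beta> i - \<beta>\<^sub>0 i\<bar> < 1" for \<beta>
  proof -
    have "\<bar>vol L I N \<beta> - vol L I N \<beta>\<^sub>0 - (\<Sum>j\<in>I. (\<lambda>_. 0) j * (\<beta> j - \<beta>\<^sub>0 j))\<bar>
        \<le> K * (\<Sum>j\<in>I. \<bar>\<beta> j - \<beta>\<^sub>0 j\<bar>)"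
    proof (rule telescope[where F = "vol L I N" and \<delta> = 1 and a = "\<lambda>_. 0" and \<beta> = \<beta> and \<beta>\<^sub>0 = \<beta>\<^sub>0,
          OF fin(2) vol_cong_bound _ near], assumption)
      fix \<beta> j s t
      assume j: "j \<in> I" and nb: "\<And>i. i \<in> I - {j} \<Longrightarrow> \<bar>\<beta> i - \<beta>\<^sub>0 i\<bar> < 1"
        and st: "\<bar>s - \<beta>\<^sub>0 j\<bar> < 1" "\<bar>t - \<beta>\<^sub>0 j\<bar> < 1" "s \<le> t"
      have h: "0 \<le> facet_vol L I N j (p j) (\<beta>(j := u)) \<and> facet_vol L I N j (p j) (\<beta>(j := u)) \<le> B j"
        if u: "s \<le> u" "u \<le> t" for u
      proof -
        have "\<bar>(\<beta>(j := u)) i - \<beta>\<^sub>0 i\<bar> < 1" if "i \<in> I" for i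
          using nb[of i] st u that by (cases "i = j") auto
        then have "\<forall>i\<in>I. \<bar>(\<beta>(j := u)) i - \<beta>\<^sub>0 i\<bar> < 1" ..
        from B(2)[OF j this] show ?thesis by (simp only: facet_vol_nonneg simp_thms)
      qed
      let ?D = "vol L I N (\<beta>(j := s)) - vol L I N (\<beta>(j := t))"
      have D: "0 * (t - s) \<le> \<bar>N j (p j)\<bar> * ?D" "\<bar>N j (p j)\<bar> * ?D \<le> B j * (t - s)"
        using vol_increment[of L "p j" I j N s t 0 \<beta> "B j"] fin bd p[OF j] j st(3) h by auto
      have "0 \<le> ?D" using D(1) p[OF j] by (simp add: zero_le_mult_iff)
      moreover have "?D \<le> B j / \<bar>N j (p j)\<bar> * (t - s)"
        using D(2) p[OF j] by (simp add: pos_le_divide_eq mult.commute)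
      moreover have "B j / \<bar>N j (p j)\<bar> \<le> K"
        unfolding K_def using fin(2) j B(1) by (intro member_le_sum) auto
      then have "B j / \<bar>N j (p j)\<bar> * (t - s) \<le> K * (t - s)" using st(3) by (intro mult_right_mono) auto
      ultimately show "\<bar>vol L I N (\<beta>(j := t)) - vol L I N (\<beta>(j := s)) - 0 * (t - s)\<bar> \<le> K * (t - s)"
        by simp
    qed
    then show ?thesis by simp
  qed
  show ?thesis
    unfolding coord_cont_def
  proof (intro allI impI)
    fix \<epsilon> :: real assume \<epsilon>: "\<epsilon> > 0"
    define \<delta> where "\<delta> = min 1 (\<epsilon> / (K * card I + 1))"
    have pos: "K * card I + 1 > 0" using K0 by (simp add: add_nonneg_pos)
    have "\<delta> \<le> \<epsilon> / (K * card I + 1)" unfolding \<delta>_def by (rule min.cobounded2)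
    then have \<delta>: "\<delta> > 0" "\<delta> \<le> 1" "\<delta> * (K * card I + 1) \<le> \<epsilon>"
      using \<epsilon> pos by (simp_all add: \<delta>_def pos_le_divide_eq[OF pos])
    show "\<exists>\<delta>>0. \<forall>\<beta>. (\<forall>i\<in>I. \<bar>\<beta> i - \<beta>\<^sub>0 i\<bar> < \<delta>) \<longrightarrow> \<bar>vol L I N \<beta> - vol L I N \<beta>\<^sub>0\<bar> < \<epsilon>"
    proof (intro exI[of _ \<delta>] conjI allI impI \<delta>(1))
      fix \<beta> assume \<beta>: "\<forall>i\<in>I. \<bar>\<beta> i - \<beta>\<^sub>0 i\<bar> < \<delta>"
      have "(\<Sum>j\<in>I. \<bar>\<beta> j - \<beta>\<^sub>0 j\<bar>) \<le> card I * \<delta>"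
        using \<beta> by (intro sum_bounded_above) auto
      then have "K * (\<Sum>j\<in>I. \<bar>\<beta> j - \<beta>\<^sub>0 j\<bar>) \<le> K * (card I * \<delta>)" using K0 by (rule mult_left_mono)
      then have "K * (\<Sum>j\<in>I. \<bar>\<beta> j - \<beta>\<^sub>0 j\<bar>) \<le> \<delta> * (K * card I)" by (simp add: mult_ac)
      also have "\<dots> < \<epsilon>" using \<delta> by (simp add: distrib_left)
      finally show "\<bar>vol L I N \<beta> - vol L I N \<beta>\<^sub>0\<bar> < \<epsilon>"
        using lip[of \<beta>] \<beta> \<delta>(2) by force
    qed
  qed
qed

lemma lin_zero: "(\<And>l. l \<in> L \<Longrightarrow> v l = 0) \<Longrightarrow> lin L v x = 0"
  unfolding lin_def by simp

lemma bounding_drop_zero: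
  assumes "bounding L I N" "\<And>z l. z \<in> Z \<Longrightarrow> l \<in> L \<Longrightarrow> N z l = 0"
  shows "bounding L (I - Z) N"
proof -
  have lin0: "lin L (N z) x = 0" if "z \<in> Z" for z x by (rule lin_zero) (rule assms(2)[OF that])
  have "(\<forall>i\<in>I - Z. - C \<le> lin L (N i) x) \<longleftrightarrow> (\<forall>i\<in>I. - C \<le> lin L (N i) x)" if "C \<ge> 0" for C x
  proof (intro iffI ballI)
    fix i assume "\<forall>i\<in>I - Z. - C \<le> lin L (N i) x" "i \<in> I"
    then show "- C \<le> lin L (N i) x" using lin0[of i x] \<open>C \<ge> 0\<close> by (cases "i \<in> Z") auto
  qed simp
  note eq = this
  show ?thesis
    unfolding bounding_def
  proof (intro allI impI)
    fix C :: real assume C: "0 \<le> C"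
    show "\<exists>M. \<forall>x. (\<forall>i\<in>I - Z. - C \<le> lin L (N i) x) \<longrightarrow> (\<forall>l\<in>L. \<bar>x l\<bar> \<le> M)"
      unfolding eq[OF C] using assms(1) C unfolding bounding_def by blast
  qed
qed

lemma vol_drop_zero:
  assumes "Z \<subseteq> I" "\<And>z l. z \<in> Z \<Longrightarrow> l \<in> L \<Longrightarrow> N z l = 0"
  shows "vol L I N \<beta> = (if \<forall>z\<in>Z. \<beta> z \<le> 0 then vol L (I - Z) N \<beta> else 0)"
proof -
  have lin0: "lin L (N z) x = 0" if "z \<in> Z" for z x by (rule lin_zero) (rule assms(2)[OF that])
  have "(\<forall>i\<in>I. \<beta> i \<le> lin L (N i) x) \<longleftrightarrow>
      (\<forall>z\<in>Z. \<beta> z \<le> 0) \<and> (\<forall>i\<in>I - Z. \<beta> i \<le> lin L (N i) x)" for x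
  proof -
    have "(\<forall>i\<in>I. \<beta> i \<le> lin L (N i) x) \<longleftrightarrow>
        (\<forall>z\<in>Z. \<beta> z \<le> lin L (N z) x) \<and> (\<forall>i\<in>I - Z. \<beta> i \<le> lin L (N i) x)"
      using assms(1) by blast
    then show ?thesis by (simp add: lin0)
  qed
  then have "cell L I N \<beta> = (if \<forall>z\<in>Z. \<beta> z \<le> 0 then cell L (I - Z) N \<beta> else {})"
    unfolding cell_def by simp
  then show ?thesis by (simp add: vol_def)
qed

text \<open>A vanishing form turns its constraint into the condition \<open>\<beta> i \<le> 0\<close>, which does not involve the
  point. The volume jumps at most where such a bound crosses \<open>0\<close>. Vanishing forms do arise, on the
  facets of a polyhedron with parallel normals.\<close>

lemma vol_coord_cont:
  assumes fin: "finite L" "finite I" and bd: "bounding L I N"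
    and nz: "\<And>i. i \<in> I \<Longrightarrow> (\<And>l. l \<in> L \<Longrightarrow> N i l = 0) \<Longrightarrow> \<beta>\<^sub>0 i \<noteq> 0"
  shows "coord_cont I (vol L I N) \<beta>\<^sub>0"
proof -
  define Z where "Z = {i \<in> I. \<forall>l\<in>L. N i l = 0}"
  have Z: "Z \<subseteq> I" "\<And>z l. z \<in> Z \<Longrightarrow> l \<in> L \<Longrightarrow> N z l = 0" "\<And>z. z \<in> Z \<Longrightarrow> \<beta>\<^sub>0 z \<noteq> 0"
    using nz by (auto simp: Z_def)
  have drop: "vol L I N \<beta> = (if \<forall>z\<in>Z. \<beta> z \<le> 0 then vol L (I - Z) N \<beta> else 0)" for \<beta>
    by (rule vol_drop_zero) (use Z in auto)
  show ?thesis
  proof (cases "\<exists>z\<in>Z. \<beta>\<^sub>0 z > 0")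
    case True
    then obtain z where z: "z \<in> Z" "\<beta>\<^sub>0 z > 0" by blast
    have "vol L I N \<beta> = 0" if "\<bar>\<beta> z - \<beta>\<^sub>0 z\<bar> < \<beta>\<^sub>0 z" for \<beta>
    proof -
      have "\<beta> z > 0" using that by linarith
      then have "\<not> (\<forall>z\<in>Z. \<beta> z \<le> 0)" using z by force
      then show ?thesis unfolding drop by (rule if_not_P)
    qed
    then have const: "\<bar>vol L I N \<beta> - vol L I N \<beta>\<^sub>0\<bar> = 0" if "\<forall>i\<in>I. \<bar>\<beta> i - \<beta>\<^sub>0 i\<bar> < \<beta>\<^sub>0 z" for \<beta>
      using that z Z(1) by (simp add: subset_iff)
    show ?thesis unfolding coord_cont_def
      by (intro allI impI exI[of _ "\<beta>\<^sub>0 z"] conjI z(2)) (simp only: const)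
  next
    case False
    then have neg: "\<And>z. z \<in> Z \<Longrightarrow> \<beta>\<^sub>0 z < 0" using Z(3) by force
    have "finite Z" using fin(2) Z(1) finite_subset by blast
    define \<eta> where "\<eta> = Min (insert 1 ((\<lambda>z. - \<beta>\<^sub>0 z) ` Z))"
    have \<eta>: "\<eta> > 0" "\<And>z. z \<in> Z \<Longrightarrow> \<eta> \<le> - \<beta>\<^sub>0 z"
      using \<open>finite Z\<close> neg by (auto simp: \<eta>_def)
    have eq: "vol L I N \<beta> = vol L (I - Z) N \<beta>" if "\<forall>i\<in>I. \<bar>\<beta> i - \<beta>\<^sub>0 i\<bar> < \<eta>" for \<beta>
    proof -
      have "\<beta> z \<le> 0" if "z \<in> Z" for z
        using \<eta>(2)[OF that] \<open>\<forall>i\<in>I. \<bar>\<beta> i - \<beta>\<^sub>0 i\<bar> < \<eta>\<close> Z(1) that by force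
      then show ?thesis using drop by simp
    qed
    have cont: "coord_cont (I - Z) (vol L (I - Z) N) \<beta>\<^sub>0"
      by (rule vol_coord_cont_nonzero[OF fin(1) finite_Diff[OF fin(2)] bounding_drop_zero[OF bd Z(2)]])
        (auto simp: Z_def)
    show ?thesis
      unfolding coord_cont_def
    proof (intro allI impI)
      fix \<epsilon> :: real assume "\<epsilon> > 0"
      then obtain \<delta> where \<delta>: "\<delta> > 0" "\<And>\<beta>. (\<forall>i\<in>I - Z. \<bar>\<beta> i - \<beta>\<^sub>0 i\<bar> < \<delta>) \<Longrightarrow>
          \<bar>vol L (I - Z) N \<beta> - vol L (I - Z) N \<beta>\<^sub>0\<bar> < \<epsilon>"
        using cont unfolding coord_cont_def by blast
      show "\<exists>\<delta>>0. \<forall>\<beta>. (\<forall>i\<in>I. \<bar>\<beta> i - \<beta>\<^sub>0 i\<bar> < \<delta>) \<longrightarrow> \<bar>vol L I N \<beta> - vol L I N \<beta>\<^sub>0\<bar> < \<epsilon>"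
        using \<delta> \<eta>(1) eq by (intro exI[of _ "min \<delta> \<eta>"]) simp
    qed
  qed
qed

lemma facet_vol_coord_cont:
  assumes fin: "finite L" "finite I" and bd: "bounding L I N"
    and j: "j \<in> I" "l \<in> L" "N j l \<noteq> 0"
    and nz: "\<And>i. i \<in> I - {j} \<Longrightarrow> (\<And>m. m \<in> L - {l} \<Longrightarrow> elim_normal N j l i m = 0)
        \<Longrightarrow> elim_bound N j l \<beta>\<^sub>0 i \<noteq> 0"
  shows "coord_cont I (facet_vol L I N j l) \<beta>\<^sub>0"
  unfolding coord_cont_def
proof (intro allI impI)
  fix \<epsilon> :: real assume "\<epsilon> > 0"
  moreover have "coord_cont (I - {j}) (vol (L - {l}) (I - {j}) (elim_normal N j l)) (elim_bound N j l \<beta>\<^sub>0)"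
    using fin bd nz bounding_elim[OF fin(1) j(2,3) bd] by (intro vol_coord_cont) auto
  ultimately obtain \<delta> where \<delta>: "\<delta> > 0" "\<And>\<beta>. (\<forall>i\<in>I - {j}. \<bar>\<beta> i - elim_bound N j l \<beta>\<^sub>0 i\<bar> < \<delta>) \<Longrightarrow>
      \<bar>vol (L - {l}) (I - {j}) (elim_normal N j l) \<beta>
       - vol (L - {l}) (I - {j}) (elim_normal N j l) (elim_bound N j l \<beta>\<^sub>0)\<bar> < \<epsilon>"
    unfolding coord_cont_def by blast
  define R where "R = (\<Sum>i\<in>I. \<bar>N i l / N j l\<bar>)"
  have R: "R \<ge> 0" "\<And>i. i \<in> I \<Longrightarrow> \<bar>N i l / N j l\<bar> \<le> R"
    unfolding R_def using fin(2) by (auto intro: sum_nonneg member_le_sum simp del: abs_divide)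
  then have "1 + R \<noteq> 0" by linarith
  show "\<exists>\<delta>>0. \<forall>\<beta>. (\<forall>i\<in>I. \<bar>\<beta> i - \<beta>\<^sub>0 i\<bar> < \<delta>) \<longrightarrow>
      \<bar>facet_vol L I N j l \<beta> - facet_vol L I N j l \<beta>\<^sub>0\<bar> < \<epsilon>"
  proof (intro exI[of _ "\<delta> / (1 + R)"] conjI allI impI)
    show "0 < \<delta> / (1 + R)" using \<delta> R by simp
    fix \<beta> assume \<beta>: "\<forall>i\<in>I. \<bar>\<beta> i - \<beta>\<^sub>0 i\<bar> < \<delta> / (1 + R)"
    have "\<bar>elim_bound N j l \<beta> i - elim_bound N j l \<beta>\<^sub>0 i\<bar> < \<delta>" if i: "i \<in> I - {j}" for i
    proof -
      have "\<bar>elim_bound N j l \<beta> i - elim_bound N j l \<beta>\<^sub>0 i\<bar>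
          = \<bar>(\<beta> i - \<beta>\<^sub>0 i) - N i l / N j l * (\<beta> j - \<beta>\<^sub>0 j)\<bar>"
        unfolding elim_bound_def right_diff_distrib by (rule arg_cong[where f = abs]) linarith
      also have "\<dots> \<le> \<bar>\<beta> i - \<beta>\<^sub>0 i\<bar> + \<bar>N i l / N j l\<bar> * \<bar>\<beta> j - \<beta>\<^sub>0 j\<bar>"
        by (metis abs_mult abs_triangle_ineq4)
      also have "\<dots> \<le> \<bar>\<beta> i - \<beta>\<^sub>0 i\<bar> + R * \<bar>\<beta> j - \<beta>\<^sub>0 j\<bar>"
        using R(2) i by (intro add_left_mono mult_right_mono) auto
      also have "\<dots> \<le> \<bar>\<beta> i - \<beta>\<^sub>0 i\<bar> + R * (\<delta> / (1 + R))"
        using R(1) \<beta> j(1) by (intro add_left_mono mult_left_mono) (auto intro: less_imp_le)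
      also have "\<dots> < \<delta> / (1 + R) + R * (\<delta> / (1 + R))" using \<beta> i by auto
      also have "\<dots> = (1 + R) * (\<delta> / (1 + R))" by (simp only: distrib_right mult_1)
      also have "\<dots> = \<delta>" using \<open>1 + R \<noteq> 0\<close> by simp
      finally show ?thesis .
    qed
    then show "\<bar>facet_vol L I N j l \<beta> - facet_vol L I N j l \<beta>\<^sub>0\<bar> < \<epsilon>"
      unfolding facet_vol_def by (intro \<delta>(2)) blast
  qed
qed

text \<open>A polyhedron shrinks at its facets: the derivative of the volume in the direction \<open>c\<close> is minus
  the sum of the facet volumes weighted by the speeds \<open>c j\<close>. The condition \<open>nz\<close> says that any two
  constraints with parallel normals have different hyperplanes at the parameter \<open>r\<close>, and makes the
  facet volumes continuous there.\<close>

lemma vol_line_has_derivative: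
  assumes fin: "finite L" "finite I" and bd: "bounding L I N"
    and p: "\<And>j. j \<in> I \<Longrightarrow> p j \<in> L \<and> N j (p j) \<noteq> 0"
    and nz: "\<And>i j. j \<in> I \<Longrightarrow> i \<in> I - {j} \<Longrightarrow>
        (\<And>m. m \<in> L - {p j} \<Longrightarrow> elim_normal N j (p j) i m = 0)
        \<Longrightarrow> elim_bound N j (p j) (\<lambda>i. b i + r * c i) i \<noteq> 0"
  shows "((\<lambda>r. vol L I N (\<lambda>i. b i + r * c i)) has_real_derivative
      (\<Sum>j\<in>I. - (c j / \<bar>N j (p j)\<bar>) * facet_vol L I N j (p j) (\<lambda>i. b i + r * c i))) (at r)"
proof -
  define \<beta>\<^sub>0 where "\<beta>\<^sub>0 = (\<lambda>i. b i + r * c i)"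
  define h where "h j = facet_vol L I N j (p j) \<beta>\<^sub>0" for j
  define S where "S = (\<Sum>j\<in>I. \<bar>c j\<bar>)"
  have S: "S \<ge> 0" unfolding S_def by (simp add: sum_nonneg)
  have cont: "coord_cont I (facet_vol L I N j (p j)) \<beta>\<^sub>0" if "j \<in> I" for j
    using facet_vol_coord_cont[OF fin bd that] p[OF that] nz[OF that] unfolding \<beta>\<^sub>0_def by blast
  have main: "\<exists>\<eta>>0. \<forall>y. y \<noteq> r \<and> \<bar>y - r\<bar> < \<eta> \<longrightarrow>
      \<bar>(vol L I N (\<lambda>i. b i + y * c i) - vol L I N \<beta>\<^sub>0) / (y - r)
        - (\<Sum>j\<in>I. - (c j / \<bar>N j (p j)\<bar>) * h j)\<bar> < \<epsilon>" if \<epsilon>: "\<epsilon> > 0" for \<epsilon>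
  proof -
    define e where "e = \<epsilon> / (S + 1)"
    have e: "e > 0" "e * S < \<epsilon>" using \<epsilon> S by (auto simp: e_def field_simps)
    have "\<exists>\<delta>. \<forall>j\<in>I. \<delta> j > 0 \<and> (\<forall>\<beta>. (\<forall>i\<in>I. \<bar>\<beta> i - \<beta>\<^sub>0 i\<bar> < \<delta> j) \<longrightarrow>
        \<bar>facet_vol L I N j (p j) \<beta> - h j\<bar> < e * \<bar>N j (p j)\<bar>)"
      using cont e(1) p unfolding coord_cont_def h_def by (intro bchoice) simp
    then obtain \<delta>' where \<delta>': "\<And>j. j \<in> I \<Longrightarrow> \<delta>' j > 0" "\<And>j \<beta>. j \<in> I \<Longrightarrow> (\<forall>i\<in>I. \<bar>\<beta> i - \<beta>\<^sub>0 i\<bar> < \<delta>' j) \<Longrightarrow>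
        \<bar>facet_vol L I N j (p j) \<beta> - h j\<bar> < e * \<bar>N j (p j)\<bar>" by blast
    define \<delta> where "\<delta> = Min (insert 1 (\<delta>' ` I))"
    have \<delta>: "\<delta> > 0" "\<And>j. j \<in> I \<Longrightarrow> \<delta> \<le> \<delta>' j"
      using fin(2) \<delta>'(1) by (auto simp: \<delta>_def)
    have lin: "\<bar>vol L I N \<beta> - vol L I N \<beta>\<^sub>0 - (\<Sum>j\<in>I. - h j / \<bar>N j (p j)\<bar> * (\<beta> j - \<beta>\<^sub>0 j))\<bar>
        \<le> e * (\<Sum>j\<in>I. \<bar>\<beta> j - \<beta>\<^sub>0 j\<bar>)"
      if near: "\<And>i. i \<in> I \<Longrightarrow> \<bar>\<beta> i - \<beta>\<^sub>0 i\<bar> < \<delta>" for \<beta>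
    proof (rule telescope[where F = "vol L I N" and \<delta> = \<delta> and a = "\<lambda>j. - h j / \<bar>N j (p j)\<bar>" and \<beta> = \<beta> and \<beta>\<^sub>0 = \<beta>\<^sub>0,
          OF fin(2) vol_cong_bound _ near], assumption)
      fix \<beta> j s t
      assume j: "j \<in> I" and nb: "\<And>i. i \<in> I - {j} \<Longrightarrow> \<bar>\<beta> i - \<beta>\<^sub>0 i\<bar> < \<delta>"
        and st: "\<bar>s - \<beta>\<^sub>0 j\<bar> < \<delta>" "\<bar>t - \<beta>\<^sub>0 j\<bar> < \<delta>" "s \<le> t"
      define n where "n = \<bar>N j (p j)\<bar>"
      have n: "n > 0" using p[OF j] by (simp add: n_def)
      \<comment> \<open>\<open>vol_increment\<close> needs a nonnegative lower bound; facet volumes are nonnegative anyway.\<close>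
      define lo where "lo = max 0 (h j - e * n)"
      have hb: "lo \<le> facet_vol L I N j (p j) (\<beta>(j := u)) \<and>
          facet_vol L I N j (p j) (\<beta>(j := u)) \<le> h j + e * n" if u: "s \<le> u" "u \<le> t" for u
      proof -
        have "\<forall>i\<in>I. \<bar>(\<beta>(j := u)) i - \<beta>\<^sub>0 i\<bar> < \<delta>' j"
          using nb st u \<delta>(2)[OF j] by (auto intro: less_le_trans)
        from \<delta>'(2)[OF j this] have "\<bar>facet_vol L I N j (p j) (\<beta>(j := u)) - h j\<bar> < e * n"
          unfolding n_def .
        then show ?thesis
          using facet_vol_nonneg[of L I N j "p j" "\<beta>(j := u)"] unfolding lo_def by linarith
      qed
      let ?D = "vol L I N (\<beta>(j := s)) - vol L I N (\<beta>(j := t))"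
      have D: "lo * (t - s) \<le> n * ?D" "n * ?D \<le> (h j + e * n) * (t - s)"
        using vol_increment[of L "p j" I j N s t lo \<beta> "h j + e * n"] fin bd p[OF j] j st(3) hb
        unfolding n_def lo_def by auto
      have "(h j - e * n) * (t - s) \<le> lo * (t - s)"
        unfolding lo_def using st(3) by (intro mult_right_mono) auto
      with D have "\<bar>n * ?D - h j * (t - s)\<bar> \<le> n * (e * (t - s))"
        by (auto simp: abs_le_iff algebra_simps)
      moreover have "n * ?D - h j * (t - s) = - (n * (vol L I N (\<beta>(j := t)) - vol L I N (\<beta>(j := s)) - - h j / n * (t - s)))"
        using n by (simp add: field_simps)
      ultimately have "n * \<bar>vol L I N (\<beta>(j := t)) - vol L I N (\<beta>(j := s)) - - h j / n * (t - s)\<bar>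
          \<le> n * (e * (t - s))" using n by (simp add: abs_mult)
      then show "\<bar>vol L I N (\<beta>(j := t)) - vol L I N (\<beta>(j := s)) - - h j / \<bar>N j (p j)\<bar> * (t - s)\<bar> \<le> e * (t - s)"
        using n unfolding n_def[symmetric] by simp
    qed
    define \<eta> where "\<eta> = \<delta> / (S + 1)"
    show ?thesis
    proof (intro exI[of _ \<eta>] conjI allI impI)
      show "\<eta> > 0" using \<delta>(1) S by (simp add: \<eta>_def)
      fix y assume y: "y \<noteq> r \<and> \<bar>y - r\<bar> < \<eta>"
      define \<beta> where "\<beta> = (\<lambda>i. b i + y * c i)"
      have diff: "\<beta> i - \<beta>\<^sub>0 i = (y - r) * c i" for i
        unfolding \<beta>_def \<beta>\<^sub>0_def by (simp add: algebra_simps)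
      have "\<bar>\<beta> i - \<beta>\<^sub>0 i\<bar> < \<delta>" if i: "i \<in> I" for i
      proof -
        have "\<bar>c i\<bar> < S + 1" using member_le_sum[OF i, of "\<lambda>i. \<bar>c i\<bar>"] fin(2) unfolding S_def by simp
        then have "\<bar>y - r\<bar> * \<bar>c i\<bar> \<le> \<bar>y - r\<bar> * (S + 1)" by (intro mult_left_mono) auto
        also have "\<dots> < \<delta>" using y S by (simp add: \<eta>_def field_simps)
        finally show ?thesis by (simp add: diff abs_mult)
      qed
      from lin[OF this]
      have *: "\<bar>vol L I N \<beta> - vol L I N \<beta>\<^sub>0 - (\<Sum>j\<in>I. - h j / \<bar>N j (p j)\<bar> * ((y - r) * c j))\<bar>
          \<le> e * (\<Sum>j\<in>I. \<bar>y - r\<bar> * \<bar>c j\<bar>)"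
        by (simp add: diff abs_mult)
      have "(\<Sum>j\<in>I. - h j / \<bar>N j (p j)\<bar> * ((y - r) * c j))
          = (y - r) * (\<Sum>j\<in>I. - (c j / \<bar>N j (p j)\<bar>) * h j)"
        unfolding sum_distrib_left by (rule sum.cong) auto
      moreover have "e * (\<Sum>j\<in>I. \<bar>y - r\<bar> * \<bar>c j\<bar>) = \<bar>y - r\<bar> * (e * S)"
        unfolding S_def sum_distrib_left by (rule sum.cong) auto
      moreover have "vol L I N \<beta> - vol L I N \<beta>\<^sub>0 = (y - r) * ((vol L I N \<beta> - vol L I N \<beta>\<^sub>0) / (y - r))"
        using y by simp
      ultimately have "\<bar>y - r\<bar> * \<bar>(vol L I N \<beta> - vol L I N \<beta>\<^sub>0) / (y - r)
          - (\<Sum>j\<in>I. - (c j / \<bar>N j (p j)\<bar>) * h j)\<bar> \<le> \<bar>y - r\<bar> * (e * S)"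
        using * by (metis abs_mult right_diff_distrib)
      then have "\<bar>(vol L I N \<beta> - vol L I N \<beta>\<^sub>0) / (y - r)
          - (\<Sum>j\<in>I. - (c j / \<bar>N j (p j)\<bar>) * h j)\<bar> \<le> e * S"
        using y by (simp only: mult_le_cancel_left_pos zero_less_abs_iff right_minus_eq not_False_eq_True)
      then show "\<bar>(vol L I N (\<lambda>i. b i + y * c i) - vol L I N \<beta>\<^sub>0) / (y - r)
          - (\<Sum>j\<in>I. - (c j / \<bar>N j (p j)\<bar>) * h j)\<bar> < \<epsilon>"
        using e(2) unfolding \<beta>_def by linarith
    qed
  qed
  show ?thesis
    unfolding has_field_derivative_iff \<beta>\<^sub>0_def[symmetric] h_def[symmetric]
    by (rule LIM_I) (use main in \<open>simp only: real_norm_def\<close>)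
qed

section \<open>Smoothness from independence of the normals\<close>

text \<open>When all bounds move affinely, so do those of each facet. This lets the inductions on the
  dimension work with functions of the single variable \<open>r\<close>.\<close>

lemma elim_bound_line:
  "elim_bound N j l (\<lambda>i. b i + r * c i) = (\<lambda>i. elim_bound N j l b i + r * elim_bound N j l c i)"
  unfolding elim_bound_def by (simp add: algebra_simps add_divide_distrib)

lemma vol_line_continuous:
  assumes "finite L" "finite I" "bounding L I N" "\<And>i. i \<in> I \<Longrightarrow> \<exists>l\<in>L. N i l \<noteq> 0"
  shows "continuous_on UNIV (\<lambda>r. vol L I N (\<lambda>i. b i + r * c i))"
  unfolding continuous_on_iff
proof (intro ballI allI impI)
  fix r \<epsilon> :: real assume "\<epsilon> > 0"
  obtain \<delta> where \<delta>: "\<delta> > 0" "\<And>\<beta>. (\<forall>i\<in>I. \<bar>\<beta> i - (b i + r * c i)\<bar> < \<delta>) \<Longrightarrow>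
      \<bar>vol L I N \<beta> - vol L I N (\<lambda>i. b i + r * c i)\<bar> < \<epsilon>"
    using vol_coord_cont_nonzero[OF assms, of "\<lambda>i. b i + r * c i"] \<open>\<epsilon> > 0\<close>
    unfolding coord_cont_def by blast
  define S where "S = (\<Sum>i\<in>I. \<bar>c i\<bar>)"
  have S: "S \<ge> 0" "\<And>i. i \<in> I \<Longrightarrow> \<bar>c i\<bar> \<le> S"
    unfolding S_def using assms(2) by (auto intro: sum_nonneg member_le_sum)
  show "\<exists>d>0. \<forall>x'\<in>UNIV. dist x' r < d \<longrightarrow>
      dist (vol L I N (\<lambda>i. b i + x' * c i)) (vol L I N (\<lambda>i. b i + r * c i)) < \<epsilon>"
  proof (intro exI[of _ "\<delta> / (S + 1)"] conjI ballI impI)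
    show "\<delta> / (S + 1) > 0" using \<delta>(1) S(1) by simp
    fix y assume y: "dist y r < \<delta> / (S + 1)"
    have "\<bar>b i + y * c i - (b i + r * c i)\<bar> < \<delta>" if i: "i \<in> I" for i
    proof -
      have "\<bar>b i + y * c i - (b i + r * c i)\<bar> = \<bar>y - r\<bar> * \<bar>c i\<bar>"
        by (simp add: abs_mult[symmetric] algebra_simps)
      also have "\<dots> \<le> \<bar>y - r\<bar> * (S + 1)" using S(2)[OF i] by (intro mult_left_mono) auto
      also have "\<dots> < \<delta>" using y S(1) by (simp add: dist_real_def pos_less_divide_eq)
      finally show ?thesis .
    qed
    then show "dist (vol L I N (\<lambda>i. b i + y * c i)) (vol L I N (\<lambda>i. b i + r * c i)) < \<epsilon>"
      unfolding dist_real_def by (intro \<delta>(2)) blast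
  qed
qed

lemma class_C_on_lincomb:
  assumes "finite J" "\<And>j. j \<in> J \<Longrightarrow> class_C_on n (f j) S"
  shows "class_C_on n (\<lambda>x. \<Sum>j\<in>J. a j * f j x) S"
proof -
  have "\<exists>D. \<forall>j\<in>J. (\<forall>x\<in>S. D j 0 x = f j x) \<and>
      (\<forall>k<n. \<forall>x\<in>S. (D j k has_real_derivative D j (Suc k) x) (at x within S)) \<and>
      (\<forall>k\<le>n. continuous_on S (D j k))"
    using assms(2) unfolding class_C_on_def by (intro bchoice) blast
  then obtain D where D: "\<And>j x. j \<in> J \<Longrightarrow> x \<in> S \<Longrightarrow> D j 0 x = f j x"
    "\<And>j k x. j \<in> J \<Longrightarrow> k < n \<Longrightarrow> x \<in> S \<Longrightarrow> (D j k has_real_derivative D j (Suc k) x) (at x within S)"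
    "\<And>j k. j \<in> J \<Longrightarrow> k \<le> n \<Longrightarrow> continuous_on S (D j k)" by blast
  show ?thesis
    unfolding class_C_on_def
  proof (intro exI[of _ "\<lambda>k x. \<Sum>j\<in>J. a j * D j k x"] conjI ballI allI impI)
    fix x assume "x \<in> S"
    then show "(\<Sum>j\<in>J. a j * D j 0 x) = (\<Sum>j\<in>J. a j * f j x)" using D(1) by (intro sum.cong) auto
  next
    fix k x assume "k < n" "x \<in> S"
    then show "((\<lambda>x. \<Sum>j\<in>J. a j * D j k x) has_real_derivative (\<Sum>j\<in>J. a j * D j (Suc k) x)) (at x within S)"
      using D(2) by (intro DERIV_sum DERIV_cmult) auto
  next
    fix k assume "k \<le> n"
    then show "continuous_on S (\<lambda>x. \<Sum>j\<in>J. a j * D j k x)"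
      using D(3) by (intro continuous_intros) auto
  qed
qed

lemma class_C_on_Suc:
  assumes "class_C_on n f' S"
    and f: "\<And>x. x \<in> S \<Longrightarrow> (f has_real_derivative f' x) (at x within S)"
  shows "class_C_on (Suc n) f S"
proof -
  obtain D where D: "\<And>x. x \<in> S \<Longrightarrow> D 0 x = f' x"
    "\<And>k x. k < n \<Longrightarrow> x \<in> S \<Longrightarrow> (D k has_real_derivative D (Suc k) x) (at x within S)"
    "\<And>k. k \<le> n \<Longrightarrow> continuous_on S (D k)"
    using assms(1) unfolding class_C_on_def by blast
  have "continuous_on S f"
    using f by (meson DERIV_continuous continuous_on_eq_continuous_within)
  then show ?thesis
    unfolding class_C_on_def
    \<comment> \<open>Prepend \<open>f\<close> to the sequence of derivatives of \<open>f'\<close>.\<close>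
    by (intro exI[of _ "case_nat f D"] conjI ballI allI impI)
      (use D f in \<open>auto split: nat.split\<close>)
qed

lemma class_C_on_const: "class_C_on n (\<lambda>_. a) S"
  unfolding class_C_on_def
  by (intro exI[of _ "\<lambda>k _. if k = 0 then a else 0"]) (auto intro!: derivative_eq_intros)

lemma class_C_on_subset:
  assumes "class_C_on n f T" "S \<subseteq> T" "\<And>x. x \<in> S \<Longrightarrow> f x = g x"
  shows "class_C_on n g S"
proof -
  obtain D where D: "\<And>x. x \<in> T \<Longrightarrow> D 0 x = f x"
    "\<And>k x. k < n \<Longrightarrow> x \<in> T \<Longrightarrow> (D k has_real_derivative D (Suc k) x) (at x within T)"
    "\<And>k. k \<le> n \<Longrightarrow> continuous_on T (D k)"
    using assms(1) unfolding class_C_on_def by blast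
  show ?thesis
    unfolding class_C_on_def
  proof (intro exI[of _ D] conjI ballI allI impI)
    show "D 0 x = g x" if "x \<in> S" for x using D(1)[of x] assms(2,3) that by auto
    show "(D k has_real_derivative D (Suc k) x) (at x within S)" if "k < n" "x \<in> S" for k x
      using D(2)[of k x] assms(2) that by (meson DERIV_subset subsetD)
    show "continuous_on S (D k)" if "k \<le> n" for k
      using D(3)[OF that] assms(2) continuous_on_subset by blast
  qed
qed

text \<open>Independence as a family, so that a repeated row counts as dependent.\<close>

definition independent_rows :: "'l set \<Rightarrow> ('i \<Rightarrow> 'l \<Rightarrow> real) \<Rightarrow> 'i set \<Rightarrow> bool" where
  "independent_rows L N S \<longleftrightarrow>
     (\<forall>a. (\<forall>m\<in>L. (\<Sum>i\<in>S. a i * N i m) = 0) \<longrightarrow> (\<forall>i\<in>S. a i = 0))"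

lemma independent_rows_nonzero:
  assumes "independent_rows L N {i}"
  shows "\<exists>l\<in>L. N i l \<noteq> 0"
  using assms[unfolded independent_rows_def, rule_format, of "\<lambda>_. 1"] by auto

text \<open>Eliminating a coordinate with the row \<open>j\<close> is one step of Gaussian elimination, that is, it
  computes modulo \<open>N j\<close>. A relation between the reduced rows lifts to one between the original
  rows and \<open>N j\<close>.\<close>

lemma independent_rows_elim:
  assumes "finite S" "j \<notin> S" "N j l \<noteq> 0" "independent_rows L N (insert j S)"
  shows "independent_rows (L - {l}) (elim_normal N j l) S"
  unfolding independent_rows_def
proof (intro allI impI)
  fix a assume a: "\<forall>m\<in>L - {l}. (\<Sum>i\<in>S. a i * elim_normal N j l i m) = 0"
  \<comment> \<open>The coefficient of row \<open>j\<close> collects what the elimination has subtracted.\<close>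
  define a' where "a' = a(j := - (\<Sum>i\<in>S. a i * (N i l / N j l)))"
  have "(\<Sum>i\<in>insert j S. a' i * N i m) = (\<Sum>i\<in>S. a i * elim_normal N j l i m)" for m
  proof -
    have "(\<Sum>i\<in>S. a' i * N i m) = (\<Sum>i\<in>S. a i * N i m)"
      using assms(2) by (intro sum.cong) (auto simp: a'_def)
    then have "(\<Sum>i\<in>insert j S. a' i * N i m)
        = (\<Sum>i\<in>S. a i * N i m) - (\<Sum>i\<in>S. a i * (N i l / N j l)) * N j m"
      using assms(1,2) by (simp add: a'_def)
    also have "\<dots> = (\<Sum>i\<in>S. a i * elim_normal N j l i m)"
      unfolding elim_normal_def sum_distrib_right sum_subtractf[symmetric]
      by (intro sum.cong) (auto simp: algebra_simps)
    finally show ?thesis .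
  qed
  moreover have "elim_normal N j l i l = 0" for i using assms(3) by (simp add: elim_normal_def)
  ultimately have "(\<Sum>i\<in>insert j S. a' i * N i m) = 0" if "m \<in> L" for m
    using a that by (cases "m = l") auto
  then have "\<forall>i\<in>insert j S. a' i = 0" using assms(4) unfolding independent_rows_def by blast
  then show "\<forall>i\<in>S. a i = 0" using assms(2) unfolding a'_def by (metis fun_upd_other insertI2)
qed

text \<open>One derivative costs one degree of independence: the derivative is a combination of facet
  volumes, and any \<open>Suc n\<close> normals of a facet are independent when any \<open>Suc (Suc n)\<close> normals of the
  polyhedron are. The induction ends with nonzero normals, where the volume is still
  continuous.\<close>

lemma vol_line_class_C:
  assumes "finite L" "finite I" "bounding L I N"
    and "\<And>S. S \<subseteq> I \<Longrightarrow> card S \<le> Suc n \<Longrightarrow> independent_rows L N S"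
  shows "class_C_on n (\<lambda>r. vol L I N (\<lambda>i. b i + r * c i)) UNIV"
  using assms
proof (induction n arbitrary: L I N b c)
  case 0
  have "continuous_on UNIV (\<lambda>r. vol L I N (\<lambda>i. b i + r * c i))"
    using 0(4)[of "{_}"] by (intro vol_line_continuous independent_rows_nonzero 0(1,2,3)) auto
  then show ?case unfolding class_C_on_def
    by (intro exI[of _ "\<lambda>_ r. vol L I N (\<lambda>i. b i + r * c i)"]) auto
next
  case (Suc n)
  note fin = Suc.prems(1,2) and bd = Suc.prems(3)
  have "\<exists>l\<in>L. N j l \<noteq> 0" if "j \<in> I" for j
    using that by (intro independent_rows_nonzero Suc.prems(4)) auto
  then obtain p where p: "\<And>j. j \<in> I \<Longrightarrow> p j \<in> L \<and> N j (p j) \<noteq> 0" by metis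
  have ind: "independent_rows (L - {p j}) (elim_normal N j (p j)) S"
    if "j \<in> I" "S \<subseteq> I - {j}" "card S \<le> Suc n" for j S
  proof (rule independent_rows_elim)
    show "finite S" using that fin(2) by (meson finite_Diff finite_subset)
    then show "independent_rows L N (insert j S)"
      using that by (intro Suc.prems(4)) (auto simp: card_insert_if)
  qed (use that p in auto)
  have deriv: "((\<lambda>r. vol L I N (\<lambda>i. b i + r * c i)) has_real_derivative
      (\<Sum>j\<in>I. - (c j / \<bar>N j (p j)\<bar>) * facet_vol L I N j (p j) (\<lambda>i. b i + r * c i))) (at r)" for r
  proof (rule vol_line_has_derivative[OF fin bd p])
    fix i j assume ij: "j \<in> I" "i \<in> I - {j}"
      and zero: "\<And>m. m \<in> L - {p j} \<Longrightarrow> elim_normal N j (p j) i m = 0"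
    have "independent_rows (L - {p j}) (elim_normal N j (p j)) {i}" using ij by (intro ind) auto
    from independent_rows_nonzero[OF this] zero
    show "elim_bound N j (p j) (\<lambda>i. b i + r * c i) i \<noteq> 0" by blast
  qed
  have "class_C_on n (\<lambda>r. \<Sum>j\<in>I. - (c j / \<bar>N j (p j)\<bar>) * facet_vol L I N j (p j) (\<lambda>i. b i + r * c i)) UNIV"
  proof (rule class_C_on_lincomb[OF fin(2)])
    fix j assume j: "j \<in> I"
    show "class_C_on n (\<lambda>r. facet_vol L I N j (p j) (\<lambda>i. b i + r * c i)) UNIV"
      unfolding facet_vol_def elim_bound_line
      by (rule Suc.IH) (use fin ind[OF j] bounding_elim[of L "p j" N j I] bd p[OF j] in auto)
  qed
  then show ?case by (rule class_C_on_Suc) (rule deriv)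
qed

section \<open>Piecewise polynomiality\<close>

text \<open>Nothing is said about the values at the exceptional points, where the facet volumes may jump.
  Quantifying over all connected sets off \<open>E\<close> spares an ordering of the exceptional points and covers
  the unbounded phases.\<close>

definition piecewise_poly :: "nat \<Rightarrow> (real \<Rightarrow> real) \<Rightarrow> bool" where
  "piecewise_poly d f \<longleftrightarrow>
     (\<exists>E. finite E \<and> (\<forall>C. connected C \<and> C \<inter> E = {} \<longrightarrow>
        (\<exists>p. degree p \<le> d \<and> (\<forall>x\<in>C. f x = poly p x))))"

lemma piecewise_poly_const: "piecewise_poly d (\<lambda>_. a)"
  unfolding piecewise_poly_def
  by (intro exI[of _ "{}"] conjI allI impI) (auto intro!: exI[of _ "[:a:]"])

lemma piecewise_poly_lincomb:
  assumes "finite J" "\<And>j. j \<in> J \<Longrightarrow> piecewise_poly d (f j)"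
  shows "piecewise_poly d (\<lambda>x. \<Sum>j\<in>J. a j * f j x)"
proof -
  have "\<exists>E. \<forall>j\<in>J. finite (E j) \<and> (\<forall>C. connected C \<and> C \<inter> E j = {} \<longrightarrow>
        (\<exists>p. degree p \<le> d \<and> (\<forall>x\<in>C. f j x = poly p x)))"
    using assms(2) unfolding piecewise_poly_def by (intro bchoice) blast
  then obtain E where E': "\<forall>j\<in>J. finite (E j) \<and> (\<forall>C. connected C \<and> C \<inter> E j = {} \<longrightarrow>
        (\<exists>p. degree p \<le> d \<and> (\<forall>x\<in>C. f j x = poly p x)))" ..
  have E: "finite (E j)" "\<And>C. connected C \<Longrightarrow> C \<inter> E j = {} \<Longrightarrow>
        \<exists>p. degree p \<le> d \<and> (\<forall>x\<in>C. f j x = poly p x)" if "j \<in> J" for j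
    using bspec[OF E' that] by simp_all
  show ?thesis
    unfolding piecewise_poly_def
  proof (intro exI[of _ "\<Union>(E ` J)"] conjI allI impI)
    show "finite (\<Union>(E ` J))" using assms(1) E(1) by blast
    fix C :: "real set" assume C: "connected C \<and> C \<inter> \<Union>(E ` J) = {}"
    have "\<forall>j\<in>J. \<exists>p. degree p \<le> d \<and> (\<forall>x\<in>C. f j x = poly p x)"
    proof
      fix j assume "j \<in> J"
      then show "\<exists>p. degree p \<le> d \<and> (\<forall>x\<in>C. f j x = poly p x)" using C by (intro E(2)) auto
    qed
    from bchoice[OF this] obtain p where p': "\<forall>j\<in>J. degree (p j) \<le> d \<and> (\<forall>x\<in>C. f j x = poly (p j) x)" ..
    have p: "degree (p j) \<le> d" "\<And>x. x \<in> C \<Longrightarrow> f j x = poly (p j) x" if "j \<in> J" for j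
      using bspec[OF p' that] by simp_all
    show "\<exists>q. degree q \<le> d \<and> (\<forall>x\<in>C. (\<Sum>j\<in>J. a j * f j x) = poly q x)"
    proof (intro exI[of _ "\<Sum>j\<in>J. smult (a j) (p j)"] conjI ballI)
      show "degree (\<Sum>j\<in>J. smult (a j) (p j)) \<le> d"
        using p(1) assms(1) by (intro degree_sum_le) (auto intro: order_trans[OF degree_smult_le])
    qed (simp add: poly_sum p(2))
  qed
qed

lemma piecewise_poly_cutoff:
  assumes "piecewise_poly d f"
  shows "piecewise_poly d (\<lambda>r. if b + r * c \<le> 0 then f r else 0)"
proof (cases "c = 0")
  case True
  then show ?thesis using assms piecewise_poly_const[of d 0] by (cases "b \<le> 0") simp_all
next
  case False
  obtain E where E: "finite E" "\<And>C. connected C \<Longrightarrow> C \<inter> E = {} \<Longrightarrow>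
      \<exists>p. degree p \<le> d \<and> (\<forall>x\<in>C. f x = poly p x)"
    using assms unfolding piecewise_poly_def by blast
  show ?thesis
    unfolding piecewise_poly_def
  proof (intro exI[of _ "insert (- b / c) E"] conjI allI impI)
    fix C assume C: "connected C \<and> C \<inter> insert (- b / c) E = {}"
    have "\<not> (b + x * c \<le> 0 \<and> b + y * c > 0)" if xy: "x \<in> C" "y \<in> C" for x y
    proof
      assume *: "b + x * c \<le> 0 \<and> b + y * c > 0"
      have "connected ((\<lambda>r. b + r * c) ` C)"
        using C by (intro connected_continuous_image continuous_intros) auto
      then have "0 \<in> (\<lambda>r. b + r * c) ` C"
        by (rule connectedD_interval[OF _ imageI[OF xy(1)] imageI[OF xy(2)]]) (use * in auto)
      then obtain z where "z \<in> C" "b + z * c = 0" by auto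
      then have "z = - b / c" using False by (simp add: field_simps)
      with \<open>z \<in> C\<close> C show False by blast
    qed
    then consider "\<forall>x\<in>C. b + x * c \<le> 0" | "\<forall>x\<in>C. \<not> b + x * c \<le> 0" by force
    then show "\<exists>p. degree p \<le> d \<and> (\<forall>x\<in>C. (if b + x * c \<le> 0 then f x else 0) = poly p x)"
    proof cases
      case 1
      then show ?thesis using E(2)[of C] C by auto
    next
      case 2
      then show ?thesis by (intro exI[of _ 0]) auto
    qed
  qed (use E in simp)
qed

lemma poly_antiderivative:
  fixes p :: "real poly"
  shows "\<exists>q. pderiv q = p \<and> degree q \<le> Suc (degree p)"
proof (intro exI conjI)
  let ?q = "\<Sum>i\<le>degree p. monom (coeff p i / real (Suc i)) (Suc i)"
  show "pderiv ?q = p"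
    using higher_pderiv_sum[of 1 "\<lambda>i. monom (coeff p i / real (Suc i)) (Suc i)" "{..degree p}"]
    by (simp add: pderiv_monom poly_as_sum_of_monoms del: of_nat_Suc)
  show "degree ?q \<le> Suc (degree p)"
    by (intro degree_sum_le) (auto intro: order_trans[OF degree_monom_le])
qed

text \<open>On an interval that avoids the exceptional points of both functions, \<open>f\<close> differs from an
  antiderivative of the polynomial \<open>g\<close> by a constant.\<close>

lemma piecewise_poly_antiderivative:
  assumes g: "piecewise_poly d g" and "finite E'"
    and f: "\<And>x. x \<notin> E' \<Longrightarrow> (f has_real_derivative g x) (at x)"
  shows "piecewise_poly (Suc d) f"
proof -
  obtain E where E: "finite E" "\<And>C. connected C \<Longrightarrow> C \<inter> E = {} \<Longrightarrow>
      \<exists>p. degree p \<le> d \<and> (\<forall>x\<in>C. g x = poly p x)"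
    using g unfolding piecewise_poly_def by blast
  show ?thesis
    unfolding piecewise_poly_def
  proof (intro exI[of _ "E \<union> E'"] conjI allI impI)
    show "finite (E \<union> E')" using E(1) assms(2) by simp
    fix C assume C: "connected C \<and> C \<inter> (E \<union> E') = {}"
    then obtain p where p: "degree p \<le> d" "\<And>x. x \<in> C \<Longrightarrow> g x = poly p x"
      using E(2)[of C] by blast
    obtain q where q: "pderiv q = p" "degree q \<le> Suc (degree p)" using poly_antiderivative by blast
    have deriv: "((\<lambda>x. f x - poly q x) has_field_derivative 0) (at x within C)" if "x \<in> C" for x
    proof -
      have "(f has_real_derivative poly p x) (at x)" using f[of x] C p(2)[OF that] that by auto
      then have "((\<lambda>x. f x - poly q x) has_field_derivative (poly p x - poly p x)) (at x)"
        using poly_DERIV[of q x] q(1) by (intro derivative_intros) auto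
      then show ?thesis by (simp add: has_field_derivative_at_within)
    qed
    have "convex C" using C by (simp add: connected_convex_1)
    from has_field_derivative_zero_constant[OF this deriv]
    obtain a where a: "\<And>x. x \<in> C \<Longrightarrow> f x - poly q x = a" by blast
    show "\<exists>p. degree p \<le> Suc d \<and> (\<forall>x\<in>C. f x = poly p x)"
    proof (intro exI[of _ "q + [:a:]"] conjI ballI)
      show "degree (q + [:a:]) \<le> Suc d" using q(2) p(1) by (intro degree_add_le) auto
      show "f x = poly (q + [:a:]) x" if "x \<in> C" for x using a[OF that] by simp
    qed
  qed
qed

lemma lin_multiple:
  "(\<And>l. l \<in> L \<Longrightarrow> v l = t * w l) \<Longrightarrow> lin L v x = t * lin L w x"
  unfolding lin_def sum_distrib_left by (intro sum.cong) auto

lemma bounding_drop_multiple: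
  assumes "bounding L I N" "j \<in> I" "i \<noteq> j" "t > 0" "\<And>l. l \<in> L \<Longrightarrow> N i l = t * N j l"
  shows "bounding L (I - {i}) N"
  unfolding bounding_def
proof (intro allI impI)
  fix C :: real assume C: "0 \<le> C"
  define C' where "C' = max C (t * C)"
  have "0 \<le> C'" using C by (simp add: C'_def)
  then obtain M where M: "\<And>x. (\<forall>i\<in>I. - C' \<le> lin L (N i) x) \<Longrightarrow> (\<forall>l\<in>L. \<bar>x l\<bar> \<le> M)"
    using assms(1) unfolding bounding_def by blast
  have "\<forall>k\<in>I. - C' \<le> lin L (N k) x" if x: "\<forall>k\<in>I - {i}. - C \<le> lin L (N k) x" for x
  proof
    fix k assume k: "k \<in> I"
    have "lin L (N i) x = t * lin L (N j) x" using assms(5) by (rule lin_multiple)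
    moreover have "t * (- C) \<le> t * lin L (N j) x" using x assms(2-4) by (intro mult_left_mono) auto
    moreover have "C \<le> C'" "t * C \<le> C'" by (simp_all add: C'_def)
    ultimately show "- C' \<le> lin L (N k) x"
    proof (cases "k = i")
      case True
      with \<open>lin L (N i) x = _\<close> \<open>t * (- C) \<le> _\<close> \<open>t * C \<le> C'\<close> show ?thesis by simp
    next
      case False
      then have "- C \<le> lin L (N k) x" using x k by simp
      then show ?thesis using \<open>C \<le> C'\<close> by linarith
    qed
  qed
  then show "\<exists>M. \<forall>x. (\<forall>i\<in>I - {i}. - C \<le> lin L (N i) x) \<longrightarrow> (\<forall>l\<in>L. \<bar>x l\<bar> \<le> M)"
    using M by (intro exI[of _ M]) blast
qed

lemma vol_drop_multiple:
  assumes "j \<in> I" "i \<noteq> j" "t > 0" "\<And>l. l \<in> L \<Longrightarrow> N i l = t * N j l" "\<beta> i = t * \<beta> j"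
  shows "vol L I N \<beta> = vol L (I - {i}) N \<beta>"
proof -
  have "lin L (N i) x = t * lin L (N j) x" for x using assms(4) by (rule lin_multiple)
  then have "\<beta> i \<le> lin L (N i) x \<longleftrightarrow> \<beta> j \<le> lin L (N j) x" for x
    using assms(3,5) by simp
  then have "cell L I N \<beta> = cell L (I - {i}) N \<beta>"
    unfolding cell_def using assms(1,2) by blast
  then show ?thesis by (simp add: vol_def)
qed

text \<open>The two constraints confine the polyhedron to a hyperplane. Its volume is a limit of volumes of
  empty polyhedra, obtained by moving one of the two half-spaces away.\<close>

lemma vol_opposite_eq_0:
  assumes fin: "finite L" "finite I" and bd: "bounding L I N"
    and nz: "\<And>i. i \<in> I \<Longrightarrow> \<exists>l\<in>L. N i l \<noteq> 0"
    and ij: "i \<in> I" "j \<in> I" "i \<noteq> j" "t < 0" "\<And>l. l \<in> L \<Longrightarrow> N i l = t * N j l" "\<beta> i = t * \<beta> j"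
  shows "vol L I N \<beta> = 0"
proof (rule ccontr)
  assume "vol L I N \<beta> \<noteq> 0"
  then have "\<bar>vol L I N \<beta>\<bar> > 0" by simp
  then obtain \<delta> where \<delta>: "\<delta> > 0" "\<And>\<beta>'. (\<forall>i\<in>I. \<bar>\<beta>' i - \<beta> i\<bar> < \<delta>) \<Longrightarrow>
      \<bar>vol L I N \<beta>' - vol L I N \<beta>\<bar> < \<bar>vol L I N \<beta>\<bar>"
    using vol_coord_cont_nonzero[OF fin bd nz, of \<beta>] unfolding coord_cont_def by blast
  let ?\<beta>' = "\<beta>(j := \<beta> j + \<delta> / 2)"
  have "cell L I N ?\<beta>' = {}"
  proof (rule equals0I)
    fix x assume x: "x \<in> cell L I N ?\<beta>'"
    have "\<beta> i \<le> lin L (N i) x" "\<beta> j + \<delta> / 2 \<le> lin L (N j) x"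
      using x ij(1-3) unfolding cell_def by force+
    moreover have "lin L (N i) x = t * lin L (N j) x" using ij(5) by (rule lin_multiple)
    ultimately have "t * \<beta> j \<le> t * lin L (N j) x" using ij(6) by simp
    then have "lin L (N j) x \<le> \<beta> j" using ij(4) by (simp add: mult_le_cancel_left)
    with \<open>\<beta> j + \<delta> / 2 \<le> _\<close> \<delta>(1) show False by simp
  qed
  then have "vol L I N ?\<beta>' = 0" by (simp add: vol_def)
  moreover have "\<forall>i\<in>I. \<bar>?\<beta>' i - \<beta> i\<bar> < \<delta>" using \<delta>(1) by simp
  from \<delta>(2)[OF this] have "\<bar>vol L I N ?\<beta>' - vol L I N \<beta>\<bar> < \<bar>vol L I N \<beta>\<bar>" .
  ultimately show False by simp
qed

lemma finite_affine_zeros: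
  fixes b c :: real
  assumes "b \<noteq> 0 \<or> c \<noteq> 0"
  shows "finite {r. b + r * c = 0}"
proof (cases "c = 0")
  case False
  then have "{r. b + r * c = 0} \<subseteq> {- b / c}" by (auto simp: field_simps)
  then show ?thesis using finite_subset by blast
qed (use assms in simp)

text \<open>The induction again passes to facets, where the degree drops with the dimension, but now parallel
  normals are possible. The hyperplanes of two parallel constraints coincide for at most one
  parameter \<open>r\<close>, which is put into the exceptional set, or for all \<open>r\<close>. In the latter case one of them is redundant if the
  normals point the same way, and the volume vanishes identically if they are opposite. A constraint
  with vanishing form is a condition on the parameter alone, and is met on a half-line, everywhere or
  nowhere.\<close>

lemma vol_line_piecewise_poly:
  assumes "finite L" "finite I" "bounding L I N"
  shows "piecewise_poly (card L) (\<lambda>r. vol L I N (\<lambda>i. b i + r * c i))"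
  using assms
proof (induction "card L + card I" arbitrary: L I N b c rule: less_induct)
  case less
  note fin = less.prems(1,2) and bd = less.prems(3)
  let ?f = "\<lambda>r. vol L I N (\<lambda>i. b i + r * c i)"
  have drop: "piecewise_poly (card L) (\<lambda>r. vol L (I - {i}) N (\<lambda>i. b i + r * c i))"
    if "i \<in> I" "bounding L (I - {i}) N" for i
    using that fin card_Diff1_less[of I i] by (intro less.hyps) auto
  consider (empty) "I = {}" | (zero) z where "z \<in> I" "\<forall>l\<in>L. N z l = 0"
    | (multiple) i j t where "i \<in> I" "j \<in> I" "i \<noteq> j" "t \<noteq> 0" "\<forall>l\<in>L. N i l = t * N j l"
        "b i = t * b j" "c i = t * c j" "\<forall>z\<in>I. \<exists>l\<in>L. N z l \<noteq> 0"
    | (generic) "I \<noteq> {}" "\<forall>z\<in>I. \<exists>l\<in>L. N z l \<noteq> 0"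
        "\<And>i j t. i \<in> I \<Longrightarrow> j \<in> I \<Longrightarrow> i \<noteq> j \<Longrightarrow> t \<noteq> 0 \<Longrightarrow> \<forall>l\<in>L. N i l = t * N j l \<Longrightarrow>
          b i = t * b j \<Longrightarrow> c i \<noteq> t * c j"
    by blast
  then show ?case
  proof cases
    case empty
    have "?f = (\<lambda>r. vol L I N b)" by (intro ext vol_cong_bound) (simp add: empty)
    then show ?thesis using piecewise_poly_const by simp
  next
    case zero
    have bd': "bounding L (I - {z}) N" by (rule bounding_drop_zero[OF bd]) (use zero in auto)
    have "vol L I N \<beta> = (if \<forall>z\<in>{z}. \<beta> z \<le> 0 then vol L (I - {z}) N \<beta> else 0)" for \<beta>
      by (rule vol_drop_zero) (use zero in auto)
    then have "?f = (\<lambda>r. if b z + r * c z \<le> 0 then vol L (I - {z}) N (\<lambda>i. b i + r * c i) else 0)"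
      by simp
    then show ?thesis using piecewise_poly_cutoff[OF drop[OF zero(1) bd']] by simp
  next
    case multiple
    have line: "b i + r * c i = t * (b j + r * c j)" for r
      using multiple(6,7) by (simp add: algebra_simps)
    show ?thesis
    proof (cases "t > 0")
      case True
      have "bounding L (I - {i}) N"
        by (rule bounding_drop_multiple[OF bd multiple(2,3) True]) (use multiple in auto)
      moreover have "?f = (\<lambda>r. vol L (I - {i}) N (\<lambda>i. b i + r * c i))"
        by (intro ext vol_drop_multiple[OF multiple(2,3) True]) (use multiple(5) line in auto)
      ultimately show ?thesis using drop[OF multiple(1)] by simp
    next
      case False
      then have t: "t < 0" using multiple(4) by simp
      have "?f = (\<lambda>r. 0)"
        by (intro ext vol_opposite_eq_0[OF fin bd _ multiple(1-3) t]) (use multiple(5,8) line in auto)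
      then show ?thesis using piecewise_poly_const by simp
    qed
  next
    case generic
    obtain p where p: "\<And>j. j \<in> I \<Longrightarrow> p j \<in> L \<and> N j (p j) \<noteq> 0" using generic(2) by metis
    \<comment> \<open>The parameters at which two constraints with parallel normals share their hyperplane.\<close>
    define E where "E = (\<Union>j\<in>I. \<Union>i\<in>{i \<in> I - {j}. \<forall>m\<in>L - {p j}. elim_normal N j (p j) i m = 0}.
        {r. elim_bound N j (p j) b i + r * elim_bound N j (p j) c i = 0})"
    have "finite E"
      unfolding E_def
    proof (intro finite_UN_I fin(2))
      fix j i assume j: "j \<in> I" and i: "i \<in> {i \<in> I - {j}. \<forall>m\<in>L - {p j}. elim_normal N j (p j) i m = 0}"
      define t where "t = N i (p j) / N j (p j)"
      have par: "\<forall>m\<in>L. N i m = t * N j m"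
      proof
        fix m assume "m \<in> L"
        show "N i m = t * N j m"
        proof (cases "m = p j")
          case True
          then show ?thesis using p[OF j] by (simp add: t_def)
        next
          case False
          then show ?thesis using i \<open>m \<in> L\<close> by (simp add: elim_normal_def t_def)
        qed
      qed
      have "t \<noteq> 0" using generic(2) i par by force
      then have "b i \<noteq> t * b j \<or> c i \<noteq> t * c j" using generic(3)[of i j t] i j par by blast
      then have "elim_bound N j (p j) b i \<noteq> 0 \<or> elim_bound N j (p j) c i \<noteq> 0"
        unfolding elim_bound_def t_def by simp
      then show "finite {r. elim_bound N j (p j) b i + r * elim_bound N j (p j) c i = 0}"
        by (rule finite_affine_zeros)
    qed (use fin in simp)
    have deriv: "(?f has_real_derivative
      (\<Sum>j\<in>I. - (c j / \<bar>N j (p j)\<bar>) * facet_vol L I N j (p j) (\<lambda>i. b i + r * c i))) (at r)"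
      if r: "r \<notin> E" for r
    proof (rule vol_line_has_derivative[OF fin bd p])
      fix i j assume "j \<in> I" "i \<in> I - {j}"
        "\<And>m. m \<in> L - {p j} \<Longrightarrow> elim_normal N j (p j) i m = 0"
      then show "elim_bound N j (p j) (\<lambda>i. b i + r * c i) i \<noteq> 0"
        using r unfolding E_def elim_bound_line by blast
    qed
    have "piecewise_poly (card L - 1)
      (\<lambda>r. \<Sum>j\<in>I. - (c j / \<bar>N j (p j)\<bar>) * facet_vol L I N j (p j) (\<lambda>i. b i + r * c i))"
    proof (rule piecewise_poly_lincomb[OF fin(2)])
      fix j assume j: "j \<in> I"
      have card: "card (L - {p j}) = card L - 1" using p[OF j] fin by simp
      have "card (L - {p j}) < card L" "card (I - {j}) < card I"
        by (intro card_Diff1_less; use p[OF j] j fin in simp)+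
      then have "piecewise_poly (card (L - {p j})) (\<lambda>r. facet_vol L I N j (p j) (\<lambda>i. b i + r * c i))"
        unfolding facet_vol_def elim_bound_line
        using fin bd p[OF j] bounding_elim[of L "p j" N j I] by (intro less.hyps) auto
      then show "piecewise_poly (card L - 1) (\<lambda>r. facet_vol L I N j (p j) (\<lambda>i. b i + r * c i))"
        unfolding card .
    qed
    then have "piecewise_poly (Suc (card L - 1)) ?f"
      using \<open>finite E\<close> by (rule piecewise_poly_antiderivative) (rule deriv)
    moreover have "card L \<noteq> 0" using generic(1) p fin by fastforce
    ultimately show ?thesis by simp
  qed
qed

section \<open>From finite exceptional sets to phases\<close>

lemma poly_eq_sum_upto:
  fixes p :: "real poly"
  assumes "degree p \<le> d" shows "poly p r = (\<Sum>k\<le>d. coeff p k * r ^ k)"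
  unfolding poly_altdef
  by (rule sum.mono_neutral_left) (use assms in \<open>auto simp: coeff_eq_0\<close>)

lemma finite_partition_points:
  fixes E :: "real set"
  assumes "finite E" "0 < R"
  obtains n :: nat and g where "g 0 = 0" "g n = R" "\<And>i. i < n \<Longrightarrow> g i < g (Suc i)"
    "\<And>i. i < n \<Longrightarrow> {g i<..<g (Suc i)} \<inter> E = {}"
proof -
  define A where "A = insert 0 (insert R (E \<inter> {0..R}))"
  have A: "finite A" "0 \<in> A" "R \<in> A" "\<And>x. x \<in> A \<Longrightarrow> 0 \<le> x \<and> x \<le> R"
    using assms by (auto simp: A_def)
  define xs where "xs = sorted_list_of_set A"
  have set: "set xs = A" using A(1) by (simp add: xs_def)
  have less: "xs ! i < xs ! j" if "i < j" "j < length xs" for i j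
    using that strict_sorted_list_of_set[of A] unfolding xs_def[symmetric] by (simp add: sorted_wrt_nth_less)
  define n where "n = length xs - 1"
  have len: "length xs = Suc n" using set A(2) by (cases xs) (auto simp: n_def)
  have bd: "0 \<le> xs ! i \<and> xs ! i \<le> R" if "i \<le> n" for i
    using A(4) set nth_mem[of i xs] that len by simp
  have idx: "\<exists>i\<le>n. xs ! i = x" if "x \<in> A" for x
    using that unfolding set[symmetric] in_set_conv_nth len by (auto simp: less_Suc_eq_le)
  have g0: "xs ! 0 = 0"
  proof -
    obtain i where i: "i \<le> n" "xs ! i = 0" using idx A(2) by blast
    show ?thesis
    proof (cases "i = 0")
      case False
      then have "xs ! 0 < 0" using less[of 0 i] i len by simp
      then show ?thesis using bd[of 0] by simp
    qed (use i in simp)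
  qed
  have gn: "xs ! n = R"
  proof -
    obtain i where i: "i \<le> n" "xs ! i = R" using idx A(3) by blast
    show ?thesis
    proof (cases "i = n")
      case False
      then have "R < xs ! n" using less[of i n] i len by simp
      then show ?thesis using bd[of n] by simp
    qed (use i in simp)
  qed
  show thesis
  proof (rule that[of "(!) xs" n])
    show "xs ! i < xs ! Suc i" if "i < n" for i using less[of i "Suc i"] that len by simp
    show "{xs ! i<..<xs ! Suc i} \<inter> E = {}" if i: "i < n" for i
    proof (rule equals0I)
      fix e assume e: "e \<in> {xs ! i<..<xs ! Suc i} \<inter> E"
      then have "e \<in> A" using bd[of i] bd[of "Suc i"] i by (auto simp: A_def)
      then obtain m where m: "m \<le> n" "xs ! m = e" using idx by blast
      have "\<not> m \<le> i" using less[of m i] e m i len by (cases "m = i") auto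
      moreover have "\<not> Suc i \<le> m" using less[of "Suc i" m] e m i len by (cases "m = Suc i") auto
      ultimately show False by simp
    qed
  qed (use g0 gn in auto)
qed

text \<open>The exceptional points in \<open>{0..max R 1}\<close>, together with the ends of this interval, serve as
  breakpoints. Continuity extends each polynomial formula from the open phase to the closed one.\<close>

lemma piecewise_poly_imp_pluri_phase:
  assumes pp: "piecewise_poly d f" and cont: "continuous_on UNIV f"
    and eq: "\<And>r. r \<ge> 0 \<Longrightarrow> \<phi> r = f r" and nn: "\<And>r. r \<ge> 0 \<Longrightarrow> \<phi> r \<ge> 0"
    and const: "\<And>r. r \<ge> R \<Longrightarrow> f r = c"
  shows "pluri_phase_steiner_like d \<phi>"
proof -
  obtain E where E: "finite E" "\<And>C. connected C \<Longrightarrow> C \<inter> E = {} \<Longrightarrow>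
      \<exists>p. degree p \<le> d \<and> (\<forall>x\<in>C. f x = poly p x)"
    using pp unfolding piecewise_poly_def by blast
  obtain n g where g: "g 0 = 0" "g n = max R 1" "\<And>i. i < n \<Longrightarrow> g i < g (Suc i)"
    "\<And>i. i < n \<Longrightarrow> {g i<..<g (Suc i)} \<inter> E = {}"
    by (rule finite_partition_points[OF E(1), of "max R 1"]) auto
  have "\<forall>i\<in>{..<n}. \<exists>p. degree p \<le> d \<and> (\<forall>x\<in>{g i<..<g (Suc i)}. f x = poly p x)"
    using E(2) g(4) by (intro ballI) auto
  from bchoice[OF this] obtain p where
    p': "\<forall>i\<in>{..<n}. degree (p i) \<le> d \<and> (\<forall>x\<in>{g i<..<g (Suc i)}. f x = poly (p i) x)" ..
  have p: "degree (p i) \<le> d" "\<And>x. x \<in> {g i<..<g (Suc i)} \<Longrightarrow> f x = poly (p i) x" if "i < n" for i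
    using bspec[OF p'] that by simp_all
  have closed: "f r = poly (p i) r" if i: "i < n" and r: "r \<in> {g i..g (Suc i)}" for i r
  proof -
    have cl: "closure {g i<..<g (Suc i)} = {g i..g (Suc i)}"
      using closure_greaterThanLessThan g(3)[OF i] by blast
    have "f r - poly (p i) r = 0"
    proof (rule continuous_constant_on_closure[where S = "{g i<..<g (Suc i)}" and f = "\<lambda>r. f r - poly (p i) r"])
      show "continuous_on (closure {g i<..<g (Suc i)}) (\<lambda>r. f r - poly (p i) r)"
        by (intro continuous_intros continuous_on_subset[OF cont]) auto
      show "r \<in> closure {g i<..<g (Suc i)}" using r unfolding cl .
    qed (use p(2)[OF i] in simp)
    then show ?thesis by simp
  qed
  have mono: "0 \<le> g i" if "i \<le> n" for i
    using that
  proof (induction i)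
    case (Suc i)
    then show ?case using g(3)[of i] by simp
  qed (simp add: g(1))
  have phase: "\<phi> r = (\<Sum>k\<le>d. coeff (p i) (d - (d - k)) * r ^ k)"
    if "i < n" "r \<in> {g i..g (Suc i)}" for i r
  proof -
    have "r \<ge> 0" using that mono[of i] by simp
    then have "\<phi> r = poly (p i) r" using closed[OF that] eq by simp
    also have "\<dots> = (\<Sum>k\<le>d. coeff (p i) (d - (d - k)) * r ^ k)"
      unfolding poly_eq_sum_upto[OF p(1)[OF that(1)]] by (rule sum.cong) auto
    finally show ?thesis .
  qed
  have last: "\<phi> r = c" if "g n \<le> r" for r
    using that eq[of r] const[of r] unfolding g(2) by simp
  have c1: "continuous_on {0..} \<phi>"
    using continuous_on_subset[OF cont, of "{0..}"] continuous_on_cong[of "{0..}" "{0..}" \<phi> f] eq by simp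
  have c2: "\<forall>r\<ge>0. \<phi> r \<ge> 0" using nn by simp
  have c3: "\<forall>i<n. g i < g (Suc i)" using g(3) by simp
  have c4: "\<forall>i<n. \<forall>r\<in>{g i..g (Suc i)}. \<phi> r = (\<Sum>k\<le>d. coeff (p i) (d - (d - k)) * r ^ k)"
    using phase by simp
  have c5: "\<exists>c. \<forall>r\<ge>g n. \<phi> r = c" using last by blast
  show ?thesis
    unfolding pluri_phase_steiner_like_def
    by (intro conjI exI[of _ n] exI[of _ g] exI[of _ "\<lambda>j i. coeff (p i) (d - j)"]; rule c1 c2 g(1) c3 c4 c5)
qed

section \<open>Polytopes and their inner parallel bodies\<close>

lemma lebesgue_polyhedron_eq_vol:
  fixes I :: "'a::euclidean_space set"
  assumes "finite I"
  shows "measure lebesgue {x. \<forall>v\<in>I. \<beta> v \<le> v \<bullet> x} = vol Basis I (\<bullet>) \<beta>"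
proof -
  let ?A = "{x. \<forall>v\<in>I. \<beta> v \<le> v \<bullet> x}"
  let ?f = "\<lambda>x. \<Sum>b\<in>Basis. x b *\<^sub>R b :: 'a"
  have "closed ?A"
    unfolding Collect_ball_eq
    by (intro closed_INT ballI closed_Collect_le continuous_intros)
  then have A: "?A \<in> sets borel" by simp
  have f: "?f \<in> measurable (Pi\<^sub>M Basis (\<lambda>_. lborel)) borel" by measurable
  have distr: "(lborel :: 'a measure) = distr (Pi\<^sub>M Basis (\<lambda>_. lborel)) borel ?f"
    by (rule lborel_eq)
  have inner: "v \<bullet> ?f x = lin Basis ((\<bullet>) v) x" for v x
    unfolding lin_def by (simp add: inner_sum_right mult.commute)
  have "measure lebesgue ?A = measure lborel ?A" using A by (simp add: measure_completion)
  also have "\<dots> = measure (Pi\<^sub>M Basis (\<lambda>_. lborel)) (?f -` ?A \<inter> space (Pi\<^sub>M Basis (\<lambda>_. lborel)))"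
    unfolding distr by (rule measure_distr[OF f A])
  also have "?f -` ?A \<inter> space (Pi\<^sub>M Basis (\<lambda>_. lborel)) = cell Basis I (\<bullet>) \<beta>"
    unfolding cell_def by (auto simp: inner)
  finally show ?thesis by (simp add: vol_def)
qed

text \<open>From a minimal family of half-spaces, whose boundaries cut out the facets. Each bound is
  attained on its facet, so it equals the infimum of the normal functional over \<open>P\<close>. This recovers
  the bound from the normal, and the constraints can be indexed by the normals themselves.\<close>

lemma polytope_halfspaces:
  fixes P :: "'a::euclidean_space set"
  assumes "full_dim_polytope P"
  obtains I b where "finite I" "I \<subseteq> inner_normals P" "\<And>v. v \<in> I \<Longrightarrow> norm v = 1"
    "P = {x. \<forall>v\<in>I. b v \<le> v \<bullet> x}"
proof -
  have P: "polyhedron P" "interior P \<noteq> {}" using assms by (auto simp: full_dim_polytope_def)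
  have aff: "affine hull P = UNIV" using P(2) affine_hull_nonempty_interior by blast
  obtain F where F: "finite F" "P = affine hull P \<inter> \<Inter>F"
    "\<forall>h\<in>F. \<exists>a b. a \<noteq> 0 \<and> h = {x. a \<bullet> x \<le> b}"
    "\<forall>F'. F' \<subset> F \<longrightarrow> P \<subset> affine hull P \<inter> \<Inter>F'"
    using P(1) unfolding polyhedron_Int_affine_minimal by blast
  obtain a c where ac: "\<And>h. h \<in> F \<Longrightarrow> a h \<noteq> 0 \<and> h = {x. a h \<bullet> x \<le> c h}"
    using F(3) by metis
  define u where "u h = - (a h /\<^sub>R norm (a h))" for h
  define b where "b v = (INF x\<in>P. v \<bullet> x)" for v
  have un: "norm (u h) = 1" if "h \<in> F" for h using ac[OF that] by (simp add: u_def)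
  have ux: "u h \<bullet> x = - (a h \<bullet> x) / norm (a h)" for h x
    by (simp add: u_def divide_inverse mult.commute)
  have Ple: "a h \<bullet> y \<le> c h" if "h \<in> F" "y \<in> P" for h y
  proof -
    have "y \<in> h" using that F(2) by blast
    then show ?thesis using ac[OF that(1)] by blast
  qed
  have facet: "P \<inter> {x. a h \<bullet> x = c h} facet_of P" if "h \<in> F" for h
    using facet_of_polyhedron_explicit[OF F(1,2) ac, of "P \<inter> {x. a h \<bullet> x = c h}"] F(4) that by blast
  have uP: "- c h / norm (a h) \<le> u h \<bullet> y" if "h \<in> F" "y \<in> P" for h y
    unfolding ux using Ple[OF that] by (intro divide_right_mono) auto
  have b: "b (u h) = - c h / norm (a h)" if h: "h \<in> F" for h
  proof -
    obtain x0 where "x0 \<in> P" "a h \<bullet> x0 = c h" using facet[OF h] by (auto simp: facet_of_def)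
    then have "- c h / norm (a h) \<in> (\<bullet>) (u h) ` P"
      using ux by (intro image_eqI[of _ _ x0]) auto
    then show ?thesis unfolding b_def using uP[OF h] by (intro cInf_eq_minimum) auto
  qed
  show thesis
  proof (rule that[of "u ` F" b])
    show "finite (u ` F)" using F(1) by simp
    show "norm v = 1" if "v \<in> u ` F" for v using that un by blast
    show "u ` F \<subseteq> inner_normals P"
    proof
      fix v assume "v \<in> u ` F"
      then obtain h where h: "h \<in> F" "v = u h" by blast
      have "inner_unit_normal P (P \<inter> {x. a h \<bullet> x = c h}) v"
        unfolding inner_unit_normal_def h(2)
        using un[OF h(1)] uP[OF h(1)] by (auto simp: inner_diff_right ux)
      then show "v \<in> inner_normals P" using facet[OF h(1)] unfolding inner_normals_def by blast
    qed
    have "x \<in> P \<longleftrightarrow> (\<forall>h\<in>F. b (u h) \<le> u h \<bullet> x)" for x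
    proof -
      have "b (u h) \<le> u h \<bullet> x \<longleftrightarrow> x \<in> h" if h: "h \<in> F" for h
      proof -
        have "norm (a h) > 0" using ac[OF h] by simp
        then have "b (u h) \<le> u h \<bullet> x \<longleftrightarrow> a h \<bullet> x \<le> c h"
          unfolding b[OF h] ux by (simp add: divide_le_cancel)
        also have "\<dots> \<longleftrightarrow> x \<in> h" using ac[OF h] by blast
        finally show ?thesis .
      qed
      moreover have "x \<in> P \<longleftrightarrow> (\<forall>h\<in>F. x \<in> h)" using F(2) unfolding aff by blast
      ultimately show ?thesis by blast
    qed
    then show "P = {x. \<forall>v\<in>u ` F. b v \<le> v \<bullet> x}" by auto
  qed
qed

lemma interior_halfspaces_strict:
  fixes P :: "'a::euclidean_space set"
  assumes "P = {x. \<forall>v\<in>I. b v \<le> v \<bullet> x}" "v \<in> I" "v \<noteq> 0" "x \<in> interior P"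
  shows "b v < v \<bullet> x"
proof -
  obtain e where e: "e > 0" "ball x e \<subseteq> P" using assms(4) mem_interior by blast
  define y where "y = x - (e / (2 * norm v)) *\<^sub>R v"
  have "dist x y = e / 2" using assms(3) e(1) by (simp add: y_def dist_norm)
  then have "y \<in> P" using e by auto
  then have "b v \<le> v \<bullet> y" using assms(1,2) by blast
  also have "v \<bullet> y = v \<bullet> x - e / (2 * norm v) * (v \<bullet> v)" by (simp add: y_def inner_diff_right)
  also have "\<dots> < v \<bullet> x" using e(1) assms(3) by simp
  finally show ?thesis .
qed

lemma frontier_halfspaces_tight:
  fixes P :: "'a::euclidean_space set"
  assumes "P = {x. \<forall>v\<in>I. b v \<le> v \<bullet> x}" "finite I" "y \<in> frontier P"
  shows "\<exists>v\<in>I. v \<bullet> y = b v"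
proof (rule ccontr)
  assume no: "\<not> ?thesis"
  have "closed P"
    unfolding assms(1) Collect_ball_eq by (intro closed_INT ballI closed_Collect_le continuous_intros)
  then have "y \<in> P" "y \<notin> interior P" using assms(3) by (auto simp: frontier_def)
  then have y: "y \<in> {x. \<forall>v\<in>I. b v < v \<bullet> x}" using no assms(1) by force
  have "open {x. \<forall>v\<in>I. b v < v \<bullet> x}"
    unfolding Collect_ball_eq
    by (intro open_INT ballI open_Collect_less continuous_intros assms(2))
  moreover have "{x. \<forall>v\<in>I. b v < v \<bullet> x} \<subseteq> P" unfolding assms(1) by (auto intro: less_imp_le)
  ultimately have "y \<in> interior P" using interior_maximal y by blast
  with \<open>y \<notin> interior P\<close> show False ..
qed

text \<open>With unit normals, \<open>v \<bullet> x - b v\<close> is the distance of \<open>x\<close> to the supporting hyperplane. Every boundary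
  point lies on one of these hyperplanes, so the distance to the boundary is at least the smallest of
  these distances. Conversely, the segment from \<open>x\<close> to its foot on any of these hyperplanes meets the
  boundary, since the foot is not interior.\<close>

lemma inner_parallel_body_halfspaces:
  fixes P :: "'a::euclidean_space set"
  assumes P: "P = {x. \<forall>v\<in>I. b v \<le> v \<bullet> x}" and fin: "finite I" and unit: "\<And>v. v \<in> I \<Longrightarrow> norm v = 1"
    and front: "frontier P \<noteq> {}" and r: "0 \<le> r"
  shows "inner_parallel_body P r = {x. \<forall>v\<in>I. b v + r \<le> v \<bullet> x}"
proof (intro set_eqI iffI)
  fix x assume x: "x \<in> {x. \<forall>v\<in>I. b v + r \<le> v \<bullet> x}"
  have "x \<in> P" using x r P by force
  moreover have "r \<le> infdist x (frontier P)"
    unfolding infdist_notempty[OF front]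
  proof (rule cINF_greatest[OF front])
    fix y assume "y \<in> frontier P"
    then obtain v where v: "v \<in> I" "v \<bullet> y = b v" using frontier_halfspaces_tight[OF P fin] by blast
    have "r \<le> v \<bullet> (x - y)" using x v by (auto simp: inner_diff_right)
    also have "\<dots> \<le> norm v * norm (x - y)" by (rule norm_cauchy_schwarz)
    finally show "r \<le> dist x y" using unit[OF v(1)] by (simp add: dist_norm)
  qed
  ultimately show "x \<in> inner_parallel_body P r" by (simp add: inner_parallel_body_def)
next
  fix x assume "x \<in> inner_parallel_body P r"
  then have x: "x \<in> P" "r \<le> infdist x (frontier P)" by (auto simp: inner_parallel_body_def)
  have "b v + r \<le> v \<bullet> x" if v: "v \<in> I" for v
  proof -
    define t where "t = v \<bullet> x - b v"
    have t: "0 \<le> t" using x(1) P v by (auto simp: t_def)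
    \<comment> \<open>The foot of \<open>x\<close> on the supporting hyperplane with normal \<open>v\<close>.\<close>
    define y where "y = x - t *\<^sub>R v"
    have vv: "v \<bullet> v = 1" using unit[OF v] by (simp add: norm_eq_1)
    have "v \<bullet> y = b v" by (simp add: y_def inner_diff_right vv t_def)
    then have "y \<notin> interior P"
      using interior_halfspaces_strict[OF P v] vv by force
    have "closed_segment x y \<inter> frontier P \<noteq> {}"
    proof (cases "y \<in> P")
      case True
      then have "y \<in> frontier P" using \<open>y \<notin> interior P\<close> closure_subset by (auto simp: frontier_def)
      then show ?thesis by auto
    next
      case False
      then show ?thesis using x(1)
        by (intro connected_Int_frontier) auto
    qed
    then obtain z where z: "z \<in> closed_segment x y" "z \<in> frontier P" by blast
    have "infdist x (frontier P) \<le> dist x z" using z(2) by (rule infdist_le)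
    also have "\<dots> \<le> dist x y" using z(1) by (metis dist_commute segment_bound(1) dist_norm)
    also have "\<dots> = t" using t unit[OF v] by (simp add: y_def dist_norm)
    finally show ?thesis using x(2) by (simp add: t_def)
  qed
  then show "x \<in> {x. \<forall>v\<in>I. b v + r \<le> v \<bullet> x}" by simp
qed

text \<open>Let \<open>x0\<close> be interior to \<open>P\<close>. If \<open>z\<close> violates the constraints by a bounded amount only, shrinking
  it towards \<open>x0\<close> by a fixed factor \<open>t\<close> moves it into the bounded set \<open>P\<close>.\<close>

lemma bounded_polyhedron_bounding:
  fixes P :: "'a::euclidean_space set"
  assumes P: "P = {x. \<forall>v\<in>I. b v \<le> v \<bullet> x}" and fin: "finite I" and nz: "\<And>v. v \<in> I \<Longrightarrow> v \<noteq> 0"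
    and "bounded P" "interior P \<noteq> {}"
  shows "bounding Basis I (\<bullet>)"
  unfolding bounding_def
proof (intro allI impI)
  fix C :: real assume C: "0 \<le> C"
  obtain x0 where x0: "x0 \<in> interior P" using assms(5) by blast
  obtain B where B: "\<And>x. x \<in> P \<Longrightarrow> norm x \<le> B" using assms(4) bounded_iff by blast
  define m where "m = Min (insert 1 ((\<lambda>v. v \<bullet> x0 - b v) ` I))"
  have m: "0 < m" "\<And>v. v \<in> I \<Longrightarrow> m \<le> v \<bullet> x0 - b v"
    using fin interior_halfspaces_strict[OF P _ nz x0] by (auto simp: m_def)
  define K where "K = 1 + (\<Sum>v\<in>I. \<bar>v \<bullet> x0\<bar>) + C"
  have K: "0 < K" using C by (simp add: K_def sum_nonneg add_pos_nonneg)
  have K': "v \<bullet> x0 + C \<le> K" if "v \<in> I" for v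
    using member_le_sum[OF that, of "\<lambda>v. \<bar>v \<bullet> x0\<bar>"] fin by (simp add: K_def)
  \<comment> \<open>Chosen so that \<open>t * (v \<bullet> x0 + C) \<le> v \<bullet> x0 - b v\<close> for all \<open>v\<close>.\<close>
  define t where "t = m / K"
  have t: "0 < t" using m K by (simp add: t_def)
  have "norm z \<le> B + (B + B) / t" if z: "\<And>v. v \<in> I \<Longrightarrow> - C \<le> v \<bullet> z" for z
  proof -
    define y where "y = x0 + t *\<^sub>R (z - x0)"
    have "b v \<le> v \<bullet> y" if v: "v \<in> I" for v
    proof -
      have "t * (v \<bullet> x0 + C) \<le> t * K" using K'[OF v] t by (intro mult_left_mono) auto
      also have "\<dots> = m" using K by (simp add: t_def)
      finally have "t * (v \<bullet> x0) + t * C \<le> v \<bullet> x0 - b v" using m(2)[OF v] by (simp add: distrib_left)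
      moreover have "t * (- C) \<le> t * (v \<bullet> z)" using z[OF v] t by (intro mult_left_mono) auto
      moreover have "v \<bullet> y = v \<bullet> x0 + t * (v \<bullet> z) - t * (v \<bullet> x0)"
        by (simp add: y_def inner_add_right inner_diff_right right_diff_distrib)
      ultimately show ?thesis by simp
    qed
    then have "norm y \<le> B" using B P by blast
    moreover have x0B: "norm x0 \<le> B" using B x0 interior_subset by blast
    ultimately have "norm (y - x0) \<le> B + B" by (meson norm_triangle_ineq4 add_mono order_trans)
    moreover have "z = x0 + (1 / t) *\<^sub>R (y - x0)" using t by (simp add: y_def)
    then have "norm z \<le> norm x0 + norm (y - x0) / t"
      using norm_triangle_ineq[of x0 "(1 / t) *\<^sub>R (y - x0)"] t by simp
    ultimately show ?thesis using x0B t by (meson add_mono divide_right_mono less_imp_le order_trans)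
  qed
  note bound = this
  show "\<exists>M. \<forall>x. (\<forall>v\<in>I. - C \<le> lin Basis ((\<bullet>) v) x) \<longrightarrow> (\<forall>l\<in>Basis. \<bar>x l\<bar> \<le> M)"
  proof (intro exI[of _ "B + (B + B) / t"] allI impI ballI)
    fix x and l :: 'a assume x: "\<forall>v\<in>I. - C \<le> lin Basis ((\<bullet>) v) x" and l: "l \<in> Basis"
    let ?z = "\<Sum>i\<in>Basis. x i *\<^sub>R i :: 'a"
    have "v \<bullet> ?z = lin Basis ((\<bullet>) v) x" for v
      unfolding lin_def by (simp add: inner_sum_right mult.commute)
    then have "norm ?z \<le> B + (B + B) / t" using x by (intro bound) simp
    moreover have "\<bar>x l\<bar> \<le> norm ?z" using Basis_le_norm[OF l, of ?z] l by simp
    ultimately show "\<bar>x l\<bar> \<le> B + (B + B) / t" by simp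
  qed
qed

lemma independent_imp_independent_rows:
  fixes S :: "'a::euclidean_space set"
  assumes "finite S" "independent S"
  shows "independent_rows Basis (\<bullet>) S"
  unfolding independent_rows_def
proof (intro allI impI)
  fix a assume a: "\<forall>m\<in>Basis. (\<Sum>v\<in>S. a v * (v \<bullet> m)) = 0"
  have "(\<Sum>v\<in>S. a v *\<^sub>R v) = 0"
    by (rule euclidean_eqI) (use a in \<open>simp add: inner_sum_left\<close>)
  then show "\<forall>v\<in>S. a v = 0" using assms dependent_finite[OF assms(1)] by blast
qed

text \<open>The definition speaks of subsets with exactly \<open>k\<close> elements. A smaller set extends to one of
  these, as the dependent set supplies more than \<open>k\<close> vectors.\<close>

lemma absolute_rank_independent:
  assumes "absolute_rank \<N> k" "S \<subseteq> \<N>" "finite S" "card S \<le> k"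
  shows "independent S"
proof -
  obtain T where T: "T \<subseteq> \<N>" "finite T" "card T = k + 1"
    using assms(1) unfolding absolute_rank_def by blast
  have "k \<le> card (S \<union> T)" using T card_mono[of "S \<union> T" T] assms(3) by simp
  then obtain S' where S': "S \<subseteq> S'" "S' \<subseteq> S \<union> T" "card S' = k"
    using exists_subset_between[of S k "S \<union> T"] assms(3,4) T(2) by auto
  moreover have "S' \<subseteq> \<N>" using S'(2) assms(2) T(1) by blast
  moreover have "finite S'" using S'(2) assms(3) T(2) by (meson finite_Un finite_subset)
  ultimately have "independent S'"
    using assms(1) unfolding absolute_rank_def by blast
  then show ?thesis using S'(1) independent_mono by blast
qed

lemma absolute_rank_pos:
  assumes "absolute_rank \<N> k" "0 \<notin> \<N>"
  shows "0 < k"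
proof (rule ccontr)
  assume "\<not> 0 < k"
  then obtain S where "S \<subseteq> \<N>" "card S = 1" "dependent S"
    using assms(1) unfolding absolute_rank_def by auto
  then show False using assms(2) by (auto simp: card_1_singleton_iff dependent_single)
qed

theorem corollary5:
  fixes P :: "(real ^ 'n) set" and k :: nat
  assumes "full_dim_polytope P"
    and "absolute_rank (inner_normals P) k"
  shows "pluri_phase_steiner_like CARD('n) (inner_nbhd_volume P) \<and>
         class_C_on (k - 1) (inner_nbhd_volume P) {0..}"
proof -
  have P: "compact P" "interior P \<noteq> {}" using assms(1) by (auto simp: full_dim_polytope_def)
  obtain I b where I: "finite I" "I \<subseteq> inner_normals P" "\<And>v. v \<in> I \<Longrightarrow> norm v = 1"
    and Peq: "P = {x. \<forall>v\<in>I. b v \<le> v \<bullet> x}"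
    using polytope_halfspaces[OF assms(1)] by blast
  have nz: "v \<noteq> 0" if "v \<in> I" for v using I(3)[OF that] by auto
  have "P \<noteq> {}" "P \<noteq> UNIV" using P interior_subset not_compact_UNIV by auto
  then have front: "frontier P \<noteq> {}" by (simp add: frontier_eq_empty)
  obtain v0 where v0: "v0 \<in> I" using \<open>P \<noteq> UNIV\<close> Peq by auto
  have bd: "bounding Basis I (\<bullet>)"
    by (rule bounded_polyhedron_bounding[OF Peq I(1) nz compact_imp_bounded[OF P(1)] P(2)])
  \<comment> \<open>The factor \<open>1\<close> is the common speed at which all bounds of the parallel body move.\<close>
  let ?f = "\<lambda>r. vol Basis I (\<bullet>) (\<lambda>v. b v + r * 1)"
  define F where "F r = measure lebesgue P - ?f r" for r
  have body: "inner_parallel_body P r = {x. \<forall>v\<in>I. b v + r \<le> v \<bullet> x}" if "0 \<le> r" for r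
    using inner_parallel_body_halfspaces[OF Peq I(1,3) front that] .
  have V: "inner_nbhd_volume P r = F r" if r: "0 \<le> r" for r
  proof -
    have "closed (inner_parallel_body P r)"
      unfolding body[OF r] Collect_ball_eq by (intro closed_INT ballI closed_Collect_le continuous_intros)
    moreover have "inner_parallel_body P r \<subseteq> P" by (auto simp: inner_parallel_body_def)
    ultimately have "measure lebesgue (P - inner_parallel_body P r)
        = measure lebesgue P - measure lebesgue (inner_parallel_body P r)"
      using P(1) lmeasurable_compact[OF P(1)] by (intro measure_Diff) (auto simp: fmeasurable_def)
    then show ?thesis
      unfolding inner_nbhd_volume_def F_def body[OF r] lebesgue_polyhedron_eq_vol[OF I(1)] by simp
  qed
  have nonneg: "0 \<le> inner_nbhd_volume P r" for r by (simp add: inner_nbhd_volume_def)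
  obtain B where B: "\<And>x. x \<in> P \<Longrightarrow> norm x \<le> B"
    using compact_imp_bounded[OF P(1)] bounded_iff by blast
  have const: "F r = measure lebesgue P" if r: "max 0 (B - b v0 + 1) \<le> r" for r
  proof -
    have empty: "{x. \<forall>v\<in>I. b v + r \<le> v \<bullet> x} = {}"
    proof (rule equals0I)
      fix x assume x: "x \<in> {x. \<forall>v\<in>I. b v + r \<le> v \<bullet> x}"
      then have "x \<in> P" using r unfolding Peq by force
      have "v0 \<bullet> x \<le> norm v0 * norm x" by (rule norm_cauchy_schwarz)
      also have "\<dots> \<le> B" using B[OF \<open>x \<in> P\<close>] I(3)[OF v0] by simp
      finally show False using x v0 r by force
    qed
    then have "?f r = 0" using lebesgue_polyhedron_eq_vol[OF I(1), of "\<lambda>v. b v + r"] unfolding empty by simp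
    then show ?thesis by (simp add: F_def)
  qed
  \<comment> \<open>A two-term combination, so that the closure lemmas for linear combinations apply.\<close>
  have F_lincomb: "F = (\<lambda>r. \<Sum>j\<in>UNIV. (if j then measure lebesgue P else - 1) * (if j then 1 else ?f r))"
    by (simp add: F_def UNIV_bool fun_eq_iff)
  have pp: "piecewise_poly CARD('n) F"
    unfolding F_lincomb
  proof (rule piecewise_poly_lincomb)
    show "piecewise_poly CARD('n) (\<lambda>r. if j then 1 else ?f r)" for j
      using piecewise_poly_const vol_line_piecewise_poly[OF finite_Basis I(1) bd, of b "\<lambda>_. 1"]
      by (cases j) simp_all
  qed simp
  have indep: "independent_rows Basis (\<bullet>) S" if "S \<subseteq> I" "card S \<le> k" for S
    using that I(1,2) finite_subset absolute_rank_independent[OF assms(2)]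
    by (intro independent_imp_independent_rows) blast+
  have "0 \<notin> inner_normals P" by (auto simp: inner_normals_def inner_unit_normal_def)
  then have k: "Suc (k - 1) = k" using absolute_rank_pos[OF assms(2)] by simp
  have C: "class_C_on (k - 1) F UNIV"
    unfolding F_lincomb
  proof (rule class_C_on_lincomb)
    have "class_C_on (k - 1) ?f UNIV"
      by (rule vol_line_class_C[OF finite_Basis I(1) bd]) (rule indep, unfold k)
    then show "class_C_on (k - 1) (\<lambda>r. if j then 1 else ?f r) UNIV" for j
      using class_C_on_const by (cases j) simp_all
  qed simp
  then have cont: "continuous_on UNIV F" unfolding class_C_on_def by (metis continuous_on_cong le0)
  show ?thesis
  proof
    show "pluri_phase_steiner_like CARD('n) (inner_nbhd_volume P)"
      by (rule piecewise_poly_imp_pluri_phase[OF pp cont V nonneg const])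
    show "class_C_on (k - 1) (inner_nbhd_volume P) {0..}"
      by (rule class_C_on_subset[OF C subset_UNIV]) (simp add: V)
  qed
qed

end
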